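(* Let $N\ge3$, $\bar\mu:=\left(\frac{N-2}{2}\right)^2$, $2^*=\frac{2N}{N-2}$, and $2^*-1\le p\le (p-1)\frac N2-1<q$. For $\mu\in[0,\bar\mu)$ put $\nu:=\sqrt{\bar\mu}-\sqrt{\bar\mu-\mu}$, and let $\Omega\subseteq\mathbb{R}^N$ be a smooth domain (bounded or unbounded) with $0\in\Omega$. Let $\tilde\rho:=\frac12\min\{\rho_0,\rho\}$, where $\rho_0,\rho>0$ are the small radii described in the context. Then there exist $\mu^*=\mu^*(N,q)>0$ and a constant $C$ depending on $N,p,q,\mu$ such that any solution $u$ of $$-\Delta u-\mu\frac{u}{|x|^2}=u^p-u^q\ \text{ in }\Omega,\qquad u>0\ \text{ in }\Omega,\qquad u\in H_0^1(\Omega)\cap L^{q+1}(\Omega),$$ satisfies, for $0<|x|<\tilde\rho$, $$|\nabla u(x)|\le\begin{cases} C|x|^{-(\nu+1)} & \text{if }\mu\in[0,\mu^* ),\\[2pt] C|x|^{-\frac{q+1}{q-1}} & \text{if }\mu\in[\mu^*,\bar\mu).\end{cases}$$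
   Context: The radii are the ones on which the following upper bounds for solutions $u$ hold: $\rho_0>0$ is a sufficiently small radius such that $u(x)\le C|x|^{-\nu}$ for $0<|x|<\rho_0$ (under the present hypotheses on $p,q$); $\rho>0$ is a sufficiently small radius such that $u(x)\le C|x|^{-\frac{2}{q-1}}$ for $0<|x|<\rho$, this bound being the one available when $q>\max\{p,\frac{2+\nu}{\nu}\}$ (when this is not the case, only $\rho_0$ is relevant). Solutions are understood in the weak sense. *)

theory Defs
  imports "HOL-Analysis.Analysis"
begin

subsection \<open>Smooth functions and smooth domains\<close>

definition grad :: "('a::real_inner \<Rightarrow> real) \<Rightarrow> 'a \<Rightarrow> 'a" where
  "grad f x = (THE D. GDERIV f x :> D)"

primrec Ck :: "nat \<Rightarrow> ('a::euclidean_space \<Rightarrow> real) \<Rightarrow> bool" where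
  "Ck 0 f \<longleftrightarrow> continuous_on UNIV f"
| "Ck (Suc k) f \<longleftrightarrow> (\<forall>x. f differentiable (at x)) \<and> (\<forall>b\<in>Basis. Ck k (\<lambda>x. grad f x \<bullet> b))"

definition smooth :: "('a::euclidean_space \<Rightarrow> real) \<Rightarrow> bool" where
  "smooth f \<longleftrightarrow> (\<forall>k. Ck k f)"

(* Near each boundary point, and after a rotation of the axes taking e to the last one, the set is
   the region strictly above a smooth graph. The value of g is only used on the hyperplane
   orthogonal to e. The set need not be bounded; the whole space qualifies (empty frontier). *)
definition smooth_domain :: "'a::euclidean_space set \<Rightarrow> bool" where
  "smooth_domain \<Omega> \<longleftrightarrow> open \<Omega> \<and> connected \<Omega> \<and> \<Omega> \<noteq> {} \<and>
     (\<forall>z\<in>frontier \<Omega>. \<exists>r>0. \<exists>e g. norm e = 1 \<and> smooth g \<and>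
        \<Omega> \<inter> ball z r = {x \<in> ball z r. g (x - (x \<bullet> e) *\<^sub>R e) < x \<bullet> e})"

subsection \<open>Lebesgue and Sobolev spaces\<close>

definition test_function :: "'a::euclidean_space set \<Rightarrow> ('a \<Rightarrow> real) \<Rightarrow> bool" where
  "test_function \<Omega> \<phi> \<longleftrightarrow> smooth \<phi> \<and> compact (closure {x. \<phi> x \<noteq> 0}) \<and> closure {x. \<phi> x \<noteq> 0} \<subseteq> \<Omega>"

definition in_Lp :: "real \<Rightarrow> 'a::euclidean_space set \<Rightarrow> ('a \<Rightarrow> 'b::euclidean_space) \<Rightarrow> bool" where
  "in_Lp s \<Omega> f \<longleftrightarrow> f \<in> borel_measurable (lebesgue_on \<Omega>) \<and>
     integrable (lebesgue_on \<Omega>) (\<lambda>x. norm (f x) powr s)"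

definition weak_gradient :: "'a::euclidean_space set \<Rightarrow> ('a \<Rightarrow> real) \<Rightarrow> ('a \<Rightarrow> 'a) \<Rightarrow> bool" where
  "weak_gradient \<Omega> u G \<longleftrightarrow>
     (\<forall>K. compact K \<and> K \<subseteq> \<Omega> \<longrightarrow> integrable (lebesgue_on K) u \<and> integrable (lebesgue_on K) G) \<and>
     (\<forall>\<phi>. test_function \<Omega> \<phi> \<longrightarrow>
        (\<integral>x. u x *\<^sub>R grad \<phi> x \<partial>lebesgue_on \<Omega>) = - (\<integral>x. \<phi> x *\<^sub>R G x \<partial>lebesgue_on \<Omega>))"

(* u lies in the closure of the test functions in the Sobolev norm of H^1, and G is its weak
   gradient. *)
definition H01_with_gradient :: "'a::euclidean_space set \<Rightarrow> ('a \<Rightarrow> real) \<Rightarrow> ('a \<Rightarrow> 'a) \<Rightarrow> bool" where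
  "H01_with_gradient \<Omega> u G \<longleftrightarrow>
     in_Lp 2 \<Omega> u \<and> in_Lp 2 \<Omega> G \<and> weak_gradient \<Omega> u G \<and>
     (\<exists>\<phi>. (\<forall>n. test_function \<Omega> (\<phi> n)) \<and>
       (\<lambda>n. (\<integral>x. (\<phi> n x - u x)\<^sup>2 \<partial>lebesgue_on \<Omega>)
           + (\<integral>x. (norm (grad (\<phi> n) x - G x))\<^sup>2 \<partial>lebesgue_on \<Omega>)) \<longlonglongrightarrow> (0::real))"

subsection \<open>The equation\<close>

definition mu_bar :: "nat \<Rightarrow> real" where
  "mu_bar N = ((real N - 2) / 2)\<^sup>2"

definition nu :: "nat \<Rightarrow> real \<Rightarrow> real" where
  "nu N \<mu> = sqrt (mu_bar N) - sqrt (mu_bar N - \<mu>)"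

definition crit_exp :: "nat \<Rightarrow> real" where
  "crit_exp N = 2 * real N / (real N - 2)"

(* u stands for its class modulo null sets, hence positivity almost everywhere. For u in H^1_0 and
   in L^{q+1}, 1 <= p <= q and dimension at least 3, all integrands below are integrable (the
   singular one by Hardy's inequality). *)
definition weak_solution ::
  "real \<Rightarrow> real \<Rightarrow> real \<Rightarrow> 'a::euclidean_space set \<Rightarrow> ('a \<Rightarrow> real) \<Rightarrow> bool" where
  "weak_solution \<mu> p q \<Omega> u \<longleftrightarrow>
     in_Lp (q + 1) \<Omega> u \<and> (AE x in lebesgue_on \<Omega>. u x > 0) \<and>
     (\<exists>G. H01_with_gradient \<Omega> u G \<and>
       (\<forall>\<phi>. test_function \<Omega> \<phi> \<longrightarrow>
          (\<integral>x. G x \<bullet> grad \<phi> x \<partial>lebesgue_on \<Omega>) - \<mu> * (\<integral>x. u x * \<phi> x / (norm x)\<^sup>2 \<partial>lebesgue_on \<Omega>)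
          = (\<integral>x. (u x powr p - u x powr q) * \<phi> x \<partial>lebesgue_on \<Omega>)))"

(* u(x) <= K |x|^(-a) for 0 < |x| < r. The normalization r <= 1 makes "r small" precise: the
   equation is not scale invariant, and constants uniform in r are only possible for bounded r. *)
definition bound_radius ::
  "'a::euclidean_space set \<Rightarrow> ('a \<Rightarrow> real) \<Rightarrow> real \<Rightarrow> real \<Rightarrow> real \<Rightarrow> bool" where
  "bound_radius \<Omega> u K a r \<longleftrightarrow> 0 < r \<and> r \<le> 1 \<and> ball 0 r \<subseteq> \<Omega> \<and>
     (AE x in lebesgue_on (ball 0 r). u x \<le> K * norm x powr (- a))"

(* The bound on the radius \<rho> is available only for q > max p ((2 + \<nu>) / \<nu>), a condition which
   fails for \<nu> = 0, where the quotient means infinity (division by zero gives 0 here). Otherwise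
   \<rho> is an arbitrary positive number, so that only \<rho>0 restricts min \<rho>0 \<rho>. *)
definition admissible_radii ::
  "nat \<Rightarrow> real \<Rightarrow> real \<Rightarrow> real \<Rightarrow> 'a::euclidean_space set \<Rightarrow> ('a \<Rightarrow> real) \<Rightarrow> real \<Rightarrow> real \<Rightarrow> real \<Rightarrow> bool" where
  "admissible_radii N p q \<mu> \<Omega> u K \<rho>0 \<rho> \<longleftrightarrow>
     bound_radius \<Omega> u K (nu N \<mu>) \<rho>0 \<and> 0 < \<rho> \<and>
     (nu N \<mu> > 0 \<and> q > max p ((2 + nu N \<mu>) / nu N \<mu>) \<longrightarrow> bound_radius \<Omega> u K (2 / (q - 1)) \<rho>)"

end

(* The weak equation says that the distributional Laplacian of u is bounded where u is bounded and
   |x| is bounded below. Mollify u at scale s = exp (-t) with a radial kernel. The derivative in t of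
   the mollification u_t is the Laplacian of u tested against a kernel of mass O(s^2), and one more
   spatial derivative costs a factor 1/s; so the gradients of u_t converge at the rate O(s), and the
   limit satisfies |grad u| <= C (M / R + H R) on a ball of radius R on which |u| <= M and
   |Laplacian u| <= H. For R = |x| / 2 the a priori bound u <= K |x|^(-a) gives M / R and H R of order
   |x|^(-a-1) as soon as a (q - 1) <= 2, which holds for a = nu below the threshold mu* at which
   nu = 2 / (q - 1), and for a = 2 / (q - 1) beyond it. *)
theory Submission
  imports Defs
begin

subsection \<open>Calculus of smooth functions\<close>

text \<open>Neither differentiability nor continuity of u is given, so the estimate has to produce
  its own differentiable representative, and the kernel is tailored to this. The time derivative of
  \<open>exp (m * t) * F (exp t *\<^sub>R (x - y))\<close> is governed by
  \<open>m * F z + z \<bullet> grad F z\<close>, which has to be \<open>- laplacian P z / 2\<close>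
  for some P supported in the unit ball. If m is the dimension, the left side is the divergence of
  \<open>F z *\<^sub>R z\<close>, so it suffices that P has gradient
  \<open>(- 2 * F z) *\<^sub>R z\<close>. Profiles made from consecutive derivatives of exp (-1/t),
  evaluated at 1 - |z|^2, have this property by construction: F = \<open>radial 1\<close>, P =
  \<open>radial 0\<close>. For the directional derivative along h the exponent rises by one, F
  becomes \<open>(z \<bullet> h) * radial 2 z\<close> and P becomes
  \<open>(z \<bullet> h) * radial 1 z\<close>; the identity persists. The kernel is not normalized,
  so the limit is a fixed mass times u. This holds almost everywhere and comes from convergence in
  L^1, where the continuous approximants are the test functions that membership in H^1_0
  supplies.\<close>

lemma grad_eq:
  fixes f :: "'a::real_inner \<Rightarrow> real"
  assumes "GDERIV f x :> D"
  shows "grad f x = D"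
  unfolding grad_def
proof (rule the_equality, fact assms)
  fix D' assume "GDERIV f x :> D'"
  then have "(\<lambda>h. h \<bullet> D') = (\<lambda>h. h \<bullet> D)"
    using assms has_derivative_unique unfolding gderiv_def by blast
  then have "(D' - D) \<bullet> (D' - D) = 0"
    by (metis inner_diff_right right_minus_eq)
  then show "D' = D" by simp
qed

lemma has_derivative_imp_GDERIV:
  fixes f :: "'a::euclidean_space \<Rightarrow> real"
  assumes "(f has_derivative f') (at x)"
  shows "GDERIV f x :> (\<Sum>b\<in>Basis. f' b *\<^sub>R b)"
proof -
  interpret linear f' using assms by (simp add: has_derivative_linear)
  have "f' h = h \<bullet> (\<Sum>b\<in>Basis. f' b *\<^sub>R b)" for h
  proof -
    have "f' h = f' (\<Sum>b\<in>Basis. (h \<bullet> b) *\<^sub>R b)" by (simp add: euclidean_representation)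
    also have "\<dots> = h \<bullet> (\<Sum>b\<in>Basis. f' b *\<^sub>R b)"
      by (simp add: sum scale inner_sum_right mult.commute)
    finally show ?thesis .
  qed
  then have "f' = (\<lambda>h. h \<bullet> (\<Sum>b\<in>Basis. f' b *\<^sub>R b))" by (rule ext)
  then show ?thesis using assms unfolding gderiv_def by metis
qed

lemma GDERIV_grad:
  fixes f :: "'a::euclidean_space \<Rightarrow> real"
  assumes "f differentiable (at x)"
  shows "GDERIV f x :> grad f x"
  using assms grad_eq has_derivative_imp_GDERIV unfolding differentiable_def by metis

lemma GDERIV_differentiable:
  fixes f :: "'a::real_inner \<Rightarrow> real"
  shows "GDERIV f x :> D \<Longrightarrow> f differentiable (at x)"
  unfolding gderiv_def differentiable_def by blast

lemma Ck_SucI: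
  fixes f :: "'a::euclidean_space \<Rightarrow> real"
  assumes "\<And>x. GDERIV f x :> D x" and "\<And>b. b \<in> Basis \<Longrightarrow> Ck k (\<lambda>x. D x \<bullet> b)"
  shows "Ck (Suc k) f"
proof -
  have "grad f = D" using assms(1) grad_eq by blast
  then show ?thesis using assms GDERIV_differentiable[OF assms(1)] by auto
qed

lemma Ck_Suc_GDERIV: "Ck (Suc k) f \<Longrightarrow> GDERIV f x :> grad f x"
  by (auto intro: GDERIV_grad)

text \<open>\<open>Ck (Suc k)\<close> constrains only the gradient, so order k must be recovered
  from it; at order 0, differentiability yields continuity. The product rule relies on this because
  it leaves one factor undifferentiated.\<close>

lemma Ck_SucD: "Ck (Suc k) f \<Longrightarrow> Ck k f"
proof (induction k arbitrary: f)
  case 0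
  then show ?case
    by (simp add: continuous_at_imp_continuous_on differentiable_imp_continuous_within)
next
  case (Suc k)
  then show ?case by (metis Ck.simps(2))
qed

lemma Ck_const: "Ck k (\<lambda>x. c)"
proof (induction k arbitrary: c)
  case (Suc k)
  show ?case by (rule Ck_SucI[where D = "\<lambda>x. 0"]) (auto simp: GDERIV_const Suc)
qed simp

lemma Ck_add: "Ck k f \<Longrightarrow> Ck k g \<Longrightarrow> Ck k (\<lambda>x. f x + g x)"
proof (induction k arbitrary: f g)
  case (Suc k)
  show ?case
  proof (rule Ck_SucI)
    show "GDERIV (\<lambda>x. f x + g x) x :> grad f x + grad g x" for x
      using Suc.prems Ck_Suc_GDERIV by (intro GDERIV_add) auto
    show "Ck k (\<lambda>x. (grad f x + grad g x) \<bullet> b)" if "b \<in> Basis" for b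
      using Suc that by (simp add: inner_add_left)
  qed
qed (simp add: continuous_on_add)

lemma Ck_mult: "Ck k f \<Longrightarrow> Ck k g \<Longrightarrow> Ck k (\<lambda>x. f x * g x)"
proof (induction k arbitrary: f g)
  case (Suc k)
  show ?case
  proof (rule Ck_SucI)
    show "GDERIV (\<lambda>x. f x * g x) x :> f x *\<^sub>R grad g x + g x *\<^sub>R grad f x" for x
      using Suc.prems Ck_Suc_GDERIV by (intro GDERIV_mult) auto
    show "Ck k (\<lambda>x. (f x *\<^sub>R grad g x + g x *\<^sub>R grad f x) \<bullet> b)" if "b \<in> Basis" for b
      using Suc.prems that Ck_SucD[of k f] Ck_SucD[of k g]
      by (auto simp: inner_add_left intro!: Ck_add Suc.IH)
  qed
qed (simp add: continuous_on_mult)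

lemma GDERIV_inner_left: "GDERIV (\<lambda>x. x \<bullet> a) x :> a"
  unfolding gderiv_def by (auto intro!: derivative_eq_intros)

lemma GDERIV_inner_self: "GDERIV (\<lambda>x. x \<bullet> x) x :> 2 *\<^sub>R x"
  unfolding gderiv_def by (auto intro!: derivative_eq_intros simp: inner_commute)

lemma GDERIV_affine:
  assumes "GDERIV f (c *\<^sub>R x + a) :> D"
  shows "GDERIV (\<lambda>x. f (c *\<^sub>R x + a)) x :> c *\<^sub>R D"
proof -
  have "((\<lambda>x. c *\<^sub>R x + a) has_derivative (\<lambda>h. c *\<^sub>R h)) (at x)"
    by (auto intro!: derivative_eq_intros)
  from has_derivative_compose[OF this assms[unfolded gderiv_def]]
  show ?thesis by (simp add: gderiv_def)
qed

lemma Ck_inner: "Ck k (\<lambda>x. x \<bullet> a)"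
proof (cases k)
  case (Suc n)
  show ?thesis unfolding Suc
    by (rule Ck_SucI[where D = "\<lambda>x. a"]) (auto simp: GDERIV_inner_left Ck_const)
qed (simp add: continuous_intros)

lemma Ck_affine: "Ck k f \<Longrightarrow> Ck k (\<lambda>x. f (c *\<^sub>R x + a))"
proof (induction k arbitrary: f)
  case 0
  then show ?case by (auto intro!: continuous_intros intro: continuous_on_compose2)
next
  case (Suc k)
  show ?case
  proof (rule Ck_SucI)
    show "GDERIV (\<lambda>x. f (c *\<^sub>R x + a)) x :> c *\<^sub>R grad f (c *\<^sub>R x + a)" for x
      using Suc.prems Ck_Suc_GDERIV by (intro GDERIV_affine) auto
    show "Ck k (\<lambda>x. (c *\<^sub>R grad f (c *\<^sub>R x + a)) \<bullet> b)" if "b \<in> Basis" for b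
      using Suc.prems Suc.IH[of "\<lambda>x. grad f x \<bullet> b"] that
      by (auto intro!: Ck_mult Ck_const)
  qed
qed

lemma smoothD: "smooth f \<Longrightarrow> GDERIV f x :> grad f x"
  unfolding smooth_def using Ck_Suc_GDERIV by blast

lemma smooth_grad: "smooth f \<Longrightarrow> b \<in> Basis \<Longrightarrow> smooth (\<lambda>x. grad f x \<bullet> b)"
  unfolding smooth_def by (metis Ck.simps(2))

lemma smooth_continuous: "smooth f \<Longrightarrow> continuous_on S f"
  unfolding smooth_def by (metis Ck.simps(1) continuous_on_subset subset_UNIV)

lemma smooth_const: "smooth (\<lambda>x. c)"
  and smooth_inner: "smooth (\<lambda>x. x \<bullet> a)"
  and smooth_add: "smooth f \<Longrightarrow> smooth g \<Longrightarrow> smooth (\<lambda>x. f x + g x)"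
  and smooth_mult: "smooth f \<Longrightarrow> smooth g \<Longrightarrow> smooth (\<lambda>x. f x * g x)"
  and smooth_affine: "smooth f \<Longrightarrow> smooth (\<lambda>x. f (c *\<^sub>R x + d))"
  for f g :: "'a::euclidean_space \<Rightarrow> real"
  unfolding smooth_def by (auto intro: Ck_const Ck_inner Ck_add Ck_mult Ck_affine)

lemma smooth_inner_self: "smooth (\<lambda>x::'a::euclidean_space. x \<bullet> x)"
proof -
  have "Ck (Suc k) (\<lambda>x::'a. x \<bullet> x)" for k
    by (rule Ck_SucI[OF GDERIV_inner_self]) (auto intro: Ck_mult Ck_const Ck_inner)
  then show ?thesis unfolding smooth_def using Ck_SucD by blast
qed

text \<open>The chain rule replaces \<open>\<phi> j\<close> by \<open>\<phi> (Suc j)\<close>.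
  Carrying the whole chain of derivatives lets the induction on the order of smoothness run with j
  arbitrary.\<close>

lemma smooth_compose_family:
  fixes \<phi> :: "nat \<Rightarrow> real \<Rightarrow> real" and f :: "'a::euclidean_space \<Rightarrow> real"
  assumes \<phi>: "\<And>j t. (\<phi> j has_real_derivative \<phi> (Suc j) t) (at t)" and f: "smooth f"
  shows "smooth (\<lambda>x. \<phi> j (f x))"
proof -
  have "Ck k (\<lambda>x. \<phi> j (f x))" for k
  proof (induction k arbitrary: j)
    case 0
    have "continuous_on UNIV (\<phi> j)"
      using \<phi> by (meson DERIV_isCont continuous_at_imp_continuous_on)
    then show ?case
      using smooth_continuous[OF f, of UNIV] by (auto intro: continuous_on_compose2)
  next
    case (Suc k)
    show ?case
    proof (rule Ck_SucI)
      show "GDERIV (\<lambda>x. \<phi> j (f x)) x :> \<phi> (Suc j) (f x) *\<^sub>R grad f x" for x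
        by (rule GDERIV_DERIV_compose[OF smoothD[OF f] \<phi>])
      show "Ck k (\<lambda>x. (\<phi> (Suc j) (f x) *\<^sub>R grad f x) \<bullet> b)" if "b \<in> Basis" for b
        using Suc smooth_grad[OF f that] by (auto intro!: Ck_mult simp: smooth_def)
    qed
  qed
  then show ?thesis by (simp add: smooth_def)
qed

subsection \<open>Derivatives of a bump function\<close>

text \<open>With y = 1/t, differentiating p(y) exp(-y) in t gives y^2 (p(y) - p'(y)) exp(-y),
  because dy/dt = -y^2.\<close>

primrec flat_poly :: "nat \<Rightarrow> real poly" where
  "flat_poly 0 = 1"
| "flat_poly (Suc k) = [:0, 0, 1:] * (flat_poly k - pderiv (flat_poly k))"

(* The k-th derivative of exp (-1/t) for t > 0, extended by zero. *)
definition flat :: "nat \<Rightarrow> real \<Rightarrow> real" where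
  "flat k t = (if t > 0 then poly (flat_poly k) (1 / t) * exp (- (1 / t)) else 0)"

lemma poly_times_exp_minus_tendsto_0:
  fixes p :: "real poly"
  shows "((\<lambda>y. poly p y * exp (- y)) \<longlongrightarrow> 0) at_top"
proof -
  have "((\<lambda>y. \<Sum>i\<le>degree p. coeff p i * (y ^ i / exp y)) \<longlongrightarrow> (\<Sum>i\<le>degree p. coeff p i * 0)) at_top"
    by (intro tendsto_intros tendsto_power_div_exp_0)
  then show ?thesis
    by (simp add: poly_altdef sum_distrib_right exp_minus divide_inverse mult.assoc)
qed

lemma DERIV_flat: "(flat k has_real_derivative flat (Suc k) t) (at t)"
proof -
  consider "t > 0" | "t < 0" | "t = 0" by linarith
  then show ?thesis
  proof cases
    case 1
    have "((\<lambda>t. poly (flat_poly k) (1 / t) * exp (- (1 / t))) has_real_derivative flat (Suc k) t) (at t)"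
      using 1 by (auto intro!: derivative_eq_intros poly_DERIV[THEN DERIV_chain2]
          simp: flat_def field_simps power2_eq_square)
    moreover have "\<forall>\<^sub>F x in nhds t. flat k x = poly (flat_poly k) (1 / x) * exp (- (1 / x))"
      using eventually_nhds_in_open[of "{0<..}" t] 1
      by (auto elim!: eventually_mono simp: flat_def)
    ultimately show ?thesis by (simp add: DERIV_cong_ev)
  next
    case 2
    have "\<forall>\<^sub>F x in nhds t. flat k x = 0"
      using eventually_nhds_in_open[of "{..<0}" t] 2
      by (auto elim!: eventually_mono simp: flat_def)
    moreover have "flat (Suc k) t = 0" using 2 by (simp add: flat_def)
    ultimately show ?thesis by (simp add: DERIV_cong_ev)
  next
    case 3
    have "((\<lambda>y. flat k y / y) \<longlongrightarrow> 0) (at_right 0)"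
    proof -
      \<comment> \<open>The difference quotient at 0 divides by y; the factor
        \<open>[:0, 1:]\<close> absorbs this, so the quotient is again a polynomial in 1/y times exp
        (-1/y).\<close>
      have "((\<lambda>y. poly ([:0, 1:] * flat_poly k) (inverse y) * exp (- inverse y)) \<longlongrightarrow> 0) (at_right 0)"
        by (rule filterlim_compose[OF poly_times_exp_minus_tendsto_0 filterlim_inverse_at_top_right])
      moreover have "\<forall>\<^sub>F y in at_right 0.
          poly ([:0, 1:] * flat_poly k) (inverse y) * exp (- inverse y) = flat k y / y"
        by (auto simp: eventually_at_filter flat_def divide_inverse)
      ultimately show ?thesis by (rule Lim_transform_eventually)
    qed
    moreover have "((\<lambda>y. flat k y / y) \<longlongrightarrow> 0) (at_left 0)"
      by (rule tendsto_eventually) (auto simp: eventually_at_filter flat_def)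
    ultimately have "((\<lambda>y. flat k y / y) \<longlongrightarrow> 0) (at 0)"
      by (simp add: filterlim_split_at)
    then show ?thesis using 3 by (simp add: has_field_derivative_iff flat_def)
  qed
qed

lemma flat_nonpos: "t \<le> 0 \<Longrightarrow> flat k t = 0"
  by (simp add: flat_def)

text \<open>\<open>flat_poly 1\<close> is y^2. Positivity of this first derivative is what makes
  \<open>radial 1\<close> usable as a mollifier.\<close>

lemma flat_1_pos: "t > 0 \<Longrightarrow> flat 1 t > 0"
  by (simp add: flat_def)

subsection \<open>Test functions and the Laplacian\<close>

definition laplacian :: "('a::euclidean_space \<Rightarrow> real) \<Rightarrow> 'a \<Rightarrow> real" where
  "laplacian f x = (\<Sum>b\<in>Basis. grad (\<lambda>y. grad f y \<bullet> b) x \<bullet> b)"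

lemma laplacian_eq:
  assumes "\<And>x. GDERIV f x :> D x" "\<And>x b. b \<in> Basis \<Longrightarrow> GDERIV (\<lambda>y. D y \<bullet> b) x :> D2 b x"
  shows "laplacian f x = (\<Sum>b\<in>Basis. D2 b x \<bullet> b)"
proof -
  have "grad f = D" using assms(1) grad_eq by blast
  then have "grad (\<lambda>y. grad f y \<bullet> b) x = D2 b x" if "b \<in> Basis" for b
    using assms(2)[OF that] by (simp add: grad_eq)
  then show ?thesis unfolding laplacian_def by (intro sum.cong) auto
qed

lemma continuous_laplacian:
  assumes "smooth f" shows "continuous_on S (laplacian f)"
  unfolding laplacian_def
  using assms by (intro continuous_on_sum smooth_continuous smooth_grad)

lemma grad_eq_0_off_support:
  fixes f :: "'a::euclidean_space \<Rightarrow> real"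
  assumes "x \<notin> closure {x. f x \<noteq> 0}"
  shows "grad f x = 0"
proof -
  have "((\<lambda>x. 0) has_derivative (\<lambda>h. 0)) (at x)" by simp
  then have "(f has_derivative (\<lambda>h. 0)) (at x)"
  proof (rule has_derivative_transform_within_open)
    show "open (- closure {x. f x \<noteq> 0})" "x \<in> - closure {x. f x \<noteq> 0}" using assms by auto
    show "0 = f y" if "y \<in> - closure {x. f x \<noteq> 0}" for y
      using that closure_subset[of "{x. f x \<noteq> 0}"] by auto
  qed
  then show ?thesis by (intro grad_eq) (simp add: gderiv_def)
qed

lemma test_function_grad:
  assumes "test_function \<Omega> f" "b \<in> Basis"
  shows "test_function \<Omega> (\<lambda>x. grad f x \<bullet> b)"
proof -
  have "{x. grad f x \<bullet> b \<noteq> 0} \<subseteq> closure {x. f x \<noteq> 0}"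
    using grad_eq_0_off_support[of _ f] by force
  then have "closure {x. grad f x \<bullet> b \<noteq> 0} \<subseteq> closure {x. f x \<noteq> 0}"
    by (simp add: closure_minimal)
  moreover from this assms(1) have "compact (closure {x. grad f x \<bullet> b \<noteq> 0})"
    by (metis bounded_subset closed_closure compact_eq_bounded_closed test_function_def)
  ultimately show ?thesis
    using assms smooth_grad by (auto simp: test_function_def)
qed

lemma laplacian_eq_0_off_support:
  assumes "x \<notin> closure {x. f x \<noteq> 0}"
  shows "laplacian f x = 0"
proof -
  have "grad (\<lambda>y. grad f y \<bullet> b) x = 0" for b
  proof (rule grad_eq_0_off_support)
    have "{x. grad f x \<bullet> b \<noteq> 0} \<subseteq> closure {x. f x \<noteq> 0}"
      using grad_eq_0_off_support[of _ f] by force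
    then show "x \<notin> closure {y. grad f y \<bullet> b \<noteq> 0}"
      using assms closure_minimal[OF _ closed_closure] by blast
  qed
  then show ?thesis by (simp add: laplacian_def)
qed

text \<open>Puts the kernel argument into the affine form in y, the variable of integration, that
  the rules for affine substitutions expect.\<close>

lemma scaled_reflection: "s *\<^sub>R (x - y) = (- s) *\<^sub>R y + s *\<^sub>R (x::'a::real_vector)"
  by (simp add: algebra_simps)

lemma laplacian_scaled:
  assumes "smooth P"
  shows "laplacian (\<lambda>y. P (s *\<^sub>R (x - y))) y = s\<^sup>2 * laplacian P (s *\<^sub>R (x - y))"
proof -
  have "laplacian (\<lambda>y. P (s *\<^sub>R (x - y))) y
      = (\<Sum>b\<in>Basis. ((- s) *\<^sub>R (- s) *\<^sub>R grad (\<lambda>y. grad P y \<bullet> b) (s *\<^sub>R (x - y))) \<bullet> b)"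
  proof (rule laplacian_eq)
    show "GDERIV (\<lambda>y. P (s *\<^sub>R (x - y))) y :> (- s) *\<^sub>R grad P (s *\<^sub>R (x - y))" for y
      unfolding scaled_reflection by (rule GDERIV_affine[OF smoothD[OF assms]])
    show "GDERIV (\<lambda>y. ((- s) *\<^sub>R grad P (s *\<^sub>R (x - y))) \<bullet> b) y
        :> (- s) *\<^sub>R (- s) *\<^sub>R grad (\<lambda>y. grad P y \<bullet> b) (s *\<^sub>R (x - y))" if "b \<in> Basis" for y b
    proof -
      have "GDERIV (\<lambda>y. (- s) * (grad P (s *\<^sub>R (x - y)) \<bullet> b)) y
        :> (- s) *\<^sub>R ((- s) *\<^sub>R grad (\<lambda>y. grad P y \<bullet> b) (s *\<^sub>R (x - y)))
           + (grad P (s *\<^sub>R (x - y)) \<bullet> b) *\<^sub>R 0"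
        unfolding scaled_reflection
        by (intro GDERIV_mult GDERIV_const GDERIV_affine[where f = "\<lambda>y. grad P y \<bullet> b"]
            smoothD[OF smooth_grad[OF assms that]])
      then show ?thesis by simp
    qed
  qed
  then show ?thesis
    by (simp add: laplacian_def sum_distrib_left power2_eq_square mult.assoc)
qed

lemma test_function_scaled:
  fixes x :: "'a::euclidean_space"
  assumes P: "smooth P" "\<And>z. norm z > 1 \<Longrightarrow> P z = 0" and s: "s > 0"
    and sub: "cball x (1 / s) \<subseteq> \<Omega>"
  shows "test_function \<Omega> (\<lambda>y. P (s *\<^sub>R (x - y)))"
proof -
  have "{y. P (s *\<^sub>R (x - y)) \<noteq> 0} \<subseteq> cball x (1 / s)"
  proof
    fix y assume "y \<in> {y. P (s *\<^sub>R (x - y)) \<noteq> 0}"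
    then have "\<not> norm (s *\<^sub>R (x - y)) > 1" using P(2) by blast
    then have "s * norm (x - y) \<le> 1" using s by simp
    then show "y \<in> cball x (1 / s)" using s by (simp add: dist_norm field_simps)
  qed
  then have "closure {y. P (s *\<^sub>R (x - y)) \<noteq> 0} \<subseteq> cball x (1 / s)"
    by (simp add: closure_minimal)
  moreover from this have "compact (closure {y. P (s *\<^sub>R (x - y)) \<noteq> 0})"
    using bounded_subset[OF bounded_cball] compact_closure
      by (metis closed_closure compact_eq_bounded_closed)
  moreover have "smooth (\<lambda>y. P (s *\<^sub>R (x - y)))"
    unfolding scaled_reflection by (rule smooth_affine[OF P(1)])
  ultimately show ?thesis using sub by (auto simp: test_function_def)
qed

lemma bounded_of_compact_support:
  fixes f :: "'a::euclidean_space \<Rightarrow> real"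
  assumes "continuous_on UNIV f" "\<And>z. norm z > 1 \<Longrightarrow> f z = 0"
  shows "\<exists>B>0. \<forall>z. \<bar>f z\<bar> \<le> B"
proof -
  have "compact (f ` cball 0 1)"
    using assms(1) by (intro compact_continuous_image) (auto intro: continuous_on_subset)
  then obtain B where "B > 0" "\<And>z. z \<in> cball 0 1 \<Longrightarrow> \<bar>f z\<bar> \<le> B"
    using bounded_pos[of "f ` cball 0 1"] compact_imp_bounded by (metis imageI real_norm_def)
  then show ?thesis using assms(2) by (metis abs_zero dual_order.strict_implies_order mem_cball_0 not_le)
qed

subsection \<open>Radial kernels\<close>

text \<open>\<open>radial 0\<close> is the standard bump exp (-1/(1 - |z|^2)). The index counts
  derivatives of the profile in the variable 1 - |z|^2, so a gradient only shifts j and multiplies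
  by -2 z.\<close>

definition radial :: "nat \<Rightarrow> 'a::euclidean_space \<Rightarrow> real" where
  "radial j z = flat j (1 - z \<bullet> z)"

lemma smooth_radial: "smooth (radial j :: 'a::euclidean_space \<Rightarrow> real)"
proof -
  have "smooth (\<lambda>z::'a. 1 + (-1) * (z \<bullet> z))"
    by (intro smooth_add smooth_const smooth_mult smooth_inner_self)
  then have "smooth (\<lambda>z::'a. 1 - z \<bullet> z)" by simp
  then show ?thesis unfolding radial_def by (rule smooth_compose_family[where \<phi> = flat, OF DERIV_flat])
qed

lemma GDERIV_radial: "GDERIV (radial j) z :> (- 2 * radial (Suc j) z) *\<^sub>R z"
proof -
  have "GDERIV (\<lambda>z. 1 - z \<bullet> z) z :> 0 - 2 *\<^sub>R z"
    by (intro GDERIV_diff GDERIV_const GDERIV_inner_self)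
  from GDERIV_DERIV_compose[OF this DERIV_flat]
  show ?thesis by (simp add: radial_def[abs_def] algebra_simps)
qed

lemma radial_eq_0: "norm z \<ge> 1 \<Longrightarrow> radial j z = 0"
  by (simp add: radial_def flat_nonpos dot_square_norm)

lemma radial_1_nonneg: "radial 1 z \<ge> 0"
  using flat_1_pos[of "1 - z \<bullet> z"] flat_nonpos[of "1 - z \<bullet> z" 1]
  by (cases "1 - z \<bullet> z > 0") (auto simp: radial_def)

lemma radial_1_pos: "norm z < 1 \<Longrightarrow> radial 1 z > 0"
  using flat_1_pos[of "1 - z \<bullet> z"] by (simp add: radial_def dot_square_norm power_less_one_iff abs_square_less_1)

lemma GDERIV_inner_radial:
  "GDERIV (\<lambda>z. (z \<bullet> a) * radial j z) z :> radial j z *\<^sub>R a - (2 * (z \<bullet> a) * radial (Suc j) z) *\<^sub>R z"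
proof -
  have "GDERIV (\<lambda>z. (z \<bullet> a) * radial j z) z
      :> (z \<bullet> a) *\<^sub>R ((- 2 * radial (Suc j) z) *\<^sub>R z) + radial j z *\<^sub>R a"
    by (intro GDERIV_mult GDERIV_inner_left GDERIV_radial)
  then show ?thesis by (simp add: algebra_simps)
qed

lemma laplacian_radial:
  fixes z :: "'a::euclidean_space"
  shows "laplacian (radial j) z
    = - 2 * real DIM('a) * radial (Suc j) z + 4 * (z \<bullet> z) * radial (Suc (Suc j)) z"
proof -
  let ?R = "radial (Suc j) z" and ?R' = "radial (Suc (Suc j)) z"
  have "laplacian (radial j) z
      = (\<Sum>b\<in>Basis. ((- 2) *\<^sub>R (?R *\<^sub>R b - (2 * (z \<bullet> b) * ?R') *\<^sub>R z)) \<bullet> b)"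
  proof (rule laplacian_eq)
    show "GDERIV (radial j) y :> (- 2 * radial (Suc j) y) *\<^sub>R y" for y :: 'a by (rule GDERIV_radial)
    show "GDERIV (\<lambda>y. ((- 2 * radial (Suc j) y) *\<^sub>R y) \<bullet> b) y
       :> (- 2) *\<^sub>R (radial (Suc j) y *\<^sub>R b - (2 * (y \<bullet> b) * radial (Suc (Suc j)) y) *\<^sub>R y)"
      for y b :: 'a
      using GDERIV_mult[OF GDERIV_const[of "-2"] GDERIV_inner_radial[of b "Suc j" y]]
      by (simp add: mult_ac)
  qed
  also have "\<dots> = (\<Sum>b\<in>Basis. - 2 * ?R + 4 * ?R' * ((z \<bullet> b) * (z \<bullet> b)))"
    by (intro sum.cong) (auto simp: algebra_simps inner_diff_left)
  also have "\<dots> = - 2 * real DIM('a) * ?R + 4 * (z \<bullet> z) * ?R'"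
    unfolding sum.distrib sum_distrib_left[symmetric] euclidean_inner[of z z, symmetric] by simp
  finally show ?thesis .
qed

text \<open>The cross term 2 a \<bullet> grad (\<open>radial j\<close>) equals -4 (z \<bullet> a)
  \<open>radial (Suc j)\<close>: a linear factor acts on a radial function like two additional
  dimensions. This is the shift that matches the exponent DIM + 1 of the differentiated
  kernel.\<close>

lemma laplacian_inner_radial:
  fixes z :: "'a::euclidean_space"
  shows "laplacian (\<lambda>z. (z \<bullet> a) * radial j z) z
    = - 2 * (real DIM('a) + 2) * (z \<bullet> a) * radial (Suc j) z
      + 4 * (z \<bullet> a) * (z \<bullet> z) * radial (Suc (Suc j)) z"
proof -
  let ?R = "radial (Suc j) z" and ?R' = "radial (Suc (Suc j)) z"
  have "laplacian (\<lambda>z. (z \<bullet> a) * radial j z) z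
      = (\<Sum>b\<in>Basis. ((a \<bullet> b) *\<^sub>R ((- 2 * ?R) *\<^sub>R z)
           - 2 *\<^sub>R ((z \<bullet> a) *\<^sub>R (?R *\<^sub>R b - (2 * (z \<bullet> b) * ?R') *\<^sub>R z) + ((z \<bullet> b) * ?R) *\<^sub>R a)) \<bullet> b)"
  proof (rule laplacian_eq)
    show "GDERIV (\<lambda>z. (z \<bullet> a) * radial j z) y
      :> radial j y *\<^sub>R a - (2 * (y \<bullet> a) * radial (Suc j) y) *\<^sub>R y" for y :: 'a
      by (rule GDERIV_inner_radial)
    show "GDERIV (\<lambda>y. (radial j y *\<^sub>R a - (2 * (y \<bullet> a) * radial (Suc j) y) *\<^sub>R y) \<bullet> b) y
       :> (a \<bullet> b) *\<^sub>R ((- 2 * radial (Suc j) y) *\<^sub>R y)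
          - 2 *\<^sub>R ((y \<bullet> a) *\<^sub>R (radial (Suc j) y *\<^sub>R b - (2 * (y \<bullet> b) * radial (Suc (Suc j)) y) *\<^sub>R y)
             + ((y \<bullet> b) * radial (Suc j) y) *\<^sub>R a)"
      for y b :: 'a
      using GDERIV_diff[OF GDERIV_mult[OF GDERIV_const[of "a \<bullet> b"] GDERIV_radial[of j y]]
        GDERIV_mult[OF GDERIV_const[of "2"] GDERIV_mult[OF GDERIV_inner_left[of a y]
          GDERIV_inner_radial[of b "Suc j" y]]]]
      by (simp add: mult_ac inner_diff_left)
  qed
  also have "\<dots> = (\<Sum>b\<in>Basis. (- 4 * ?R) * ((z \<bullet> b) * (a \<bullet> b)) - 2 * (z \<bullet> a) * ?R
      + 4 * (z \<bullet> a) * ?R' * ((z \<bullet> b) * (z \<bullet> b)))"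
    by (intro sum.cong) (auto simp: algebra_simps inner_diff_left inner_add_left)
  also have "\<dots> = (- 4 * ?R) * (z \<bullet> a) - real DIM('a) * (2 * (z \<bullet> a) * ?R)
      + 4 * (z \<bullet> a) * ?R' * (z \<bullet> z)"
    unfolding sum.distrib sum_subtractf sum_distrib_left[symmetric]
      euclidean_inner[of z z, symmetric] euclidean_inner[of z a, symmetric] by simp
  finally show ?thesis by (simp add: algebra_simps)
qed

subsection \<open>Mollification\<close>

lemma integrable_mult_bounded:
  fixes w k :: "'y \<Rightarrow> real"
  assumes "integrable M w" "k \<in> borel_measurable M" "\<And>y. \<bar>k y\<bar> \<le> B"
  shows "integrable M (\<lambda>y. w y * k y)"
proof (rule Bochner_Integration.integrable_bound)
  show "integrable M (\<lambda>y. B * w y)" using assms(1) by simp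
  show "(\<lambda>y. w y * k y) \<in> borel_measurable M" using assms(1,2) by measurable
  have "\<bar>w y\<bar> * \<bar>k y\<bar> \<le> B * \<bar>w y\<bar>" for y
    using mult_left_mono[OF assms(3)[of y] abs_ge_zero[of "w y"]] by (simp add: mult.commute)
  moreover have "0 \<le> B" using assms(3) abs_ge_zero order_trans by blast
  ultimately show "AE y in M. norm (w y * k y) \<le> norm (B * w y)" by (simp add: abs_mult)
qed

(* f may be non-measurable, because the integral of a non-integrable function is 0. *)
lemma abs_integral_le_AE:
  fixes f g :: "'y \<Rightarrow> real"
  assumes "integrable M g" "AE x in M. \<bar>f x\<bar> \<le> g x"
  shows "\<bar>\<integral>x. f x \<partial>M\<bar> \<le> (\<integral>x. g x \<partial>M)"
proof (cases "integrable M f")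
  case True
  have "\<bar>\<integral>x. f x \<partial>M\<bar> \<le> (\<integral>x. \<bar>f x\<bar> \<partial>M)" by (rule integral_abs_bound)
  also have "\<dots> \<le> (\<integral>x. g x \<partial>M)"
    using True assms by (intro integral_mono_AE) auto
  finally show ?thesis .
next
  case False
  moreover have "0 \<le> (\<integral>x. g x \<partial>M)"
  proof (rule integral_nonneg_AE)
    show "AE x in M. 0 \<le> g x" using assms(2) by eventually_elim simp
  qed
  ultimately show ?thesis by (simp add: not_integrable_integral_eq)
qed

text \<open>Dominated convergence along sequences, with a multiple of |w| as majorant. The parameter
  ranges over a normed space because the lemma serves both the scale t and the point x.\<close>

lemma has_derivative_integral_bounded_kernel:
  fixes k :: "'p::{real_normed_vector,perfect_space} \<Rightarrow> 'y \<Rightarrow> real"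
  assumes w: "integrable M w" and e: "e > 0"
    and meas: "\<And>z. k z \<in> borel_measurable M"
    and bound: "\<And>z y. z \<in> ball z0 e \<Longrightarrow> \<bar>k z y\<bar> \<le> b"
    and deriv: "\<And>z y. z \<in> ball z0 e \<Longrightarrow> ((\<lambda>z. k z y) has_derivative k' z y) (at z)"
    and dbound: "\<And>z y h. z \<in> ball z0 e \<Longrightarrow> \<bar>k' z y h\<bar> \<le> B * norm h"
    and dmeas: "\<And>h. (\<lambda>y. k' z0 y h) \<in> borel_measurable M"
  shows "((\<lambda>z. \<integral>y. w y * k z y \<partial>M) has_derivative (\<lambda>h. \<integral>y. w y * k' z0 y h \<partial>M)) (at z0)"
proof -
  have z0: "z0 \<in> ball z0 e" using e by simp
  have lin: "bounded_linear (k' z0 y)" for y using deriv[OF z0] has_derivative_bounded_linear by blast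
  have int: "integrable M (\<lambda>y. w y * k z y)" if "z \<in> ball z0 e" for z
    by (rule integrable_mult_bounded[OF w meas bound[OF that]])
  have int': "integrable M (\<lambda>y. w y * k' z0 y h)" for h
    by (rule integrable_mult_bounded[OF w dmeas dbound[OF z0]])
  let ?L = "\<lambda>h. \<integral>y. w y * k' z0 y h \<partial>M"
  have bl: "bounded_linear ?L"
  proof (rule bounded_linear_intro)
    fix h h' and r :: real
    show "?L (h + h') = ?L h + ?L h'"
      using int' by (simp add: linear_add[OF bounded_linear.linear[OF lin]] distrib_left)
    show "?L (r *\<^sub>R h) = r *\<^sub>R ?L h"
      by (simp add: linear_scale[OF bounded_linear.linear[OF lin]] mult.left_commute)
    have "\<bar>?L h\<bar> \<le> (\<integral>y. \<bar>w y\<bar> * (B * norm h) \<partial>M)"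
      using w dbound[OF z0] by (intro abs_integral_le_AE) (auto simp: abs_mult mult_left_mono)
    then show "norm (?L h) \<le> norm h * ((\<integral>y. \<bar>w y\<bar> \<partial>M) * B)"
      by (simp add: mult_ac)
  qed
  have lim: "((\<lambda>z. ((\<integral>y. w y * k z y \<partial>M) - (\<integral>y. w y * k z0 y \<partial>M) - ?L (z - z0)) /\<^sub>R norm (z - z0))
      \<longlongrightarrow> 0) (at z0)"
    unfolding tendsto_at_iff_sequentially comp_def
  proof (intro allI impI)
    fix X :: "nat \<Rightarrow> 'p"
    assume X: "\<forall>i. X i \<in> UNIV - {z0}" and X0: "X \<longlonglongrightarrow> z0"
    obtain N where N: "\<And>i. i \<ge> N \<Longrightarrow> X i \<in> ball z0 e"
      using metric_LIMSEQ_D[OF X0 e] by (auto simp: dist_commute)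
    define Y where "Y i = X (i + N)" for i
    have Y: "Y i \<in> ball z0 e" "Y i \<noteq> z0" for i using N X by (auto simp: Y_def)
    have Y0: "Y \<longlonglongrightarrow> z0" unfolding Y_def by (rule LIMSEQ_ignore_initial_segment[OF X0])
    \<comment> \<open>The normalized Taylor remainder of the kernel at \<open>z0\<close>; it tends
      to 0 for each y.\<close>
    define q where "q i y = (k (Y i) y - k z0 y - k' z0 y (Y i - z0)) /\<^sub>R norm (Y i - z0)" for i y
    have q_lim: "(\<lambda>i. q i y) \<longlonglongrightarrow> 0" for y
      using deriv[OF z0, of y] Y Y0
      unfolding has_derivative_def tendsto_at_iff_sequentially comp_def q_def
      by auto
    \<comment> \<open>One B comes from the mean value inequality on the convex ball, the other from
      the linear term at \<open>z0\<close>.\<close>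
    have q_bound: "\<bar>q i y\<bar> \<le> 2 * B" for i y
    proof -
      have "norm (k (Y i) y - k z0 y) \<le> B * norm (Y i - z0)"
      proof (rule differentiable_bound[OF convex_ball _ _ Y(1) z0])
        fix z assume z: "z \<in> ball z0 e"
        show "((\<lambda>z. k z y) has_derivative k' z y) (at z within ball z0 e)"
          using deriv[OF z] has_derivative_at_withinI by blast
        show "onorm (k' z y) \<le> B"
          using dbound[OF z] by (intro onorm_le) auto
      qed
      moreover have "\<bar>k' z0 y (Y i - z0)\<bar> \<le> B * norm (Y i - z0)" by (rule dbound[OF z0])
      ultimately have "\<bar>k (Y i) y - k z0 y - k' z0 y (Y i - z0)\<bar> \<le> 2 * B * norm (Y i - z0)" by auto
      then show ?thesis using Y(2)[of i] by (simp add: q_def abs_mult field_simps)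
    qed
    have "(\<lambda>i. \<integral>y. w y * q i y \<partial>M) \<longlonglongrightarrow> (\<integral>y. 0 \<partial>M)"
    proof (rule integral_dominated_convergence)
      show "(\<lambda>y. 0::real) \<in> borel_measurable M" by simp
      show "(\<lambda>y. w y * q i y) \<in> borel_measurable M" for i
        unfolding q_def using w meas dmeas by measurable
      show "integrable M (\<lambda>y. \<bar>w y\<bar> * (2 * B))" using w by simp
      show "AE y in M. (\<lambda>i. w y * q i y) \<longlonglongrightarrow> 0" using q_lim tendsto_mult_right_zero by blast
      show "AE y in M. norm (w y * q i y) \<le> \<bar>w y\<bar> * (2 * B)" for i
        using q_bound by (simp add: abs_mult mult_left_mono)
    qed
    moreover have "(\<integral>y. w y * q i y \<partial>M)
        = ((\<integral>y. w y * k (Y i) y \<partial>M) - (\<integral>y. w y * k z0 y \<partial>M) - ?L (Y i - z0)) /\<^sub>R norm (Y i - z0)" for i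
    proof -
      have "(\<integral>y. w y * q i y \<partial>M)
          = (\<integral>y. (w y * k (Y i) y - w y * k z0 y - w y * k' z0 y (Y i - z0)) /\<^sub>R norm (Y i - z0) \<partial>M)"
        by (simp add: q_def right_diff_distrib mult.left_commute)
      also have "\<dots> = ((\<integral>y. w y * k (Y i) y \<partial>M) - (\<integral>y. w y * k z0 y \<partial>M) - ?L (Y i - z0)) /\<^sub>R norm (Y i - z0)"
        using int[OF Y(1)[of i]] int[OF z0] int' by simp
      finally show ?thesis .
    qed
    ultimately have "(\<lambda>i. ((\<integral>y. w y * k (Y i) y \<partial>M) - (\<integral>y. w y * k z0 y \<partial>M) - ?L (Y i - z0))
        /\<^sub>R norm (Y i - z0)) \<longlonglongrightarrow> 0" by simp
    then show "(\<lambda>i. ((\<integral>y. w y * k (X i) y \<partial>M) - (\<integral>y. w y * k z0 y \<partial>M) - ?L (X i - z0))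
        /\<^sub>R norm (X i - z0)) \<longlonglongrightarrow> 0"
      unfolding Y_def by (rule LIMSEQ_offset)
  qed
  show ?thesis unfolding has_derivative_def using bl lim by (simp add: Lim_ident_at)
qed

text \<open>The scale is exp (-t), so that rescaling acts on F through the Euler field z \<bullet>
  grad. The exponent m is kept free: it is the dimension for the mollification itself, and each
  spatial derivative adds 1.\<close>

definition mollify :: "real \<Rightarrow> ('a::euclidean_space \<Rightarrow> real) \<Rightarrow> ('a \<Rightarrow> real) \<Rightarrow> real \<Rightarrow> 'a \<Rightarrow> real" where
  "mollify m F w t x = (\<integral>y. w y * (exp (m * t) * F (exp t *\<^sub>R (x - y))) \<partial>lborel)"

lemma borel_measurable_scaled:
  fixes F :: "'a::euclidean_space \<Rightarrow> real"
  assumes "continuous_on UNIV F"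
  shows "(\<lambda>y. c * F (s *\<^sub>R (x - y))) \<in> borel_measurable lborel"
proof -
  have "continuous_on UNIV (\<lambda>y. c * F (s *\<^sub>R (x - y)))"
    by (intro continuous_intros continuous_on_compose2[OF assms]) auto
  then show ?thesis by (simp add: borel_measurable_continuous_onI)
qed

text \<open>Differentiating the kernel in t gives exp (m t) times m F + z \<bullet> grad F at the
  rescaled point; \<open>eq\<close> trades this for a Laplacian, which can later be moved onto w
  through the equation.\<close>

lemma mollify_DERIV_time:
  fixes w F P :: "'a::euclidean_space \<Rightarrow> real"
  assumes w: "integrable lborel w"
    and F: "smooth F" "\<And>z. norm z > 1 \<Longrightarrow> F z = 0"
    and P: "smooth P" "\<And>z. norm z > 1 \<Longrightarrow> P z = 0"
    and eq: "\<And>z. m * F z + z \<bullet> grad F z = - laplacian P z / 2"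
  shows "((\<lambda>t. mollify m F w t x) has_real_derivative (- 1 / 2) * mollify m (laplacian P) w t x) (at t)"
proof -
  have "\<exists>B>0. \<forall>z. \<bar>F z\<bar> \<le> B"
    by (rule bounded_of_compact_support[OF smooth_continuous[OF F(1)] F(2)])
  then obtain B0 where B0: "B0 > 0" "\<And>z. \<bar>F z\<bar> \<le> B0" by auto
  have lapP: "laplacian P z = 0" if "norm z > 1" for z
  proof (rule laplacian_eq_0_off_support)
    have "{x. P x \<noteq> 0} \<subseteq> cball 0 1" 
    proof
      fix x assume "x \<in> {x. P x \<noteq> 0}"
      then show "x \<in> cball 0 1" using P(2)[of x] by (cases "norm x > 1") auto
    qed
    then have "closure {x. P x \<noteq> 0} \<subseteq> cball 0 1" by (simp add: closure_minimal)
    then show "z \<notin> closure {x. P x \<noteq> 0}" using that by auto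
  qed
  have "\<exists>B>0. \<forall>z. \<bar>laplacian P z\<bar> \<le> B"
    by (rule bounded_of_compact_support[OF continuous_laplacian[OF P(1)] lapP])
  then obtain B1 where B1: "B1 > 0" "\<And>z. \<bar>laplacian P z\<bar> \<le> B1" by auto
  \<comment> \<open>Bounds exp (m s) for all s within distance 1 of t, which makes the dominating
    constants uniform near t.\<close>
  define c where "c = exp (\<bar>m\<bar> * (\<bar>t\<bar> + 1))"
  have c: "exp (m * s) \<le> c" if "s \<in> ball t 1" for s
  proof -
    have "\<bar>s\<bar> \<le> \<bar>t\<bar> + 1" using that by (auto simp: dist_real_def)
    then have "\<bar>m * s\<bar> \<le> \<bar>m\<bar> * (\<bar>t\<bar> + 1)" by (simp add: abs_mult mult_left_mono)
    then show ?thesis by (simp add: c_def)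
  qed
  let ?k = "\<lambda>s y. exp (m * s) * F (exp s *\<^sub>R (x - y))"
  let ?d = "\<lambda>s y. exp (m * s) * (- 1 / 2 * laplacian P (exp s *\<^sub>R (x - y)))"
  have deriv: "((\<lambda>s. ?k s y) has_real_derivative ?d s y) (at s)" for s y
  proof -
    have "((\<lambda>s. F (exp s *\<^sub>R (x - y))) has_derivative (\<lambda>h. ((h * exp s) *\<^sub>R (x - y)) \<bullet> grad F (exp s *\<^sub>R (x - y)))) (at s)"
      by (rule has_derivative_compose[OF _ smoothD[OF F(1), unfolded gderiv_def], where f = "\<lambda>s. exp s *\<^sub>R (x - y)"])
         (auto intro!: derivative_eq_intros)
    then have 1: "((\<lambda>s. F (exp s *\<^sub>R (x - y))) has_real_derivative (exp s *\<^sub>R (x - y)) \<bullet> grad F (exp s *\<^sub>R (x - y))) (at s)"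
      unfolding has_field_derivative_def by (rule has_derivative_eq_rhs) (auto simp: mult_ac)
    have "((\<lambda>s. ?k s y) has_real_derivative
       exp (m * s) * (m * F (exp s *\<^sub>R (x - y)) + (exp s *\<^sub>R (x - y)) \<bullet> grad F (exp s *\<^sub>R (x - y)))) (at s)"
      by (rule derivative_eq_intros 1 refl)+ (simp add: algebra_simps)
    then show ?thesis unfolding eq by simp
  qed
  have "((\<lambda>s. \<integral>y. w y * ?k s y \<partial>lborel) has_derivative (\<lambda>h. \<integral>y. w y * (?d t y * h) \<partial>lborel)) (at t)"
  proof (rule has_derivative_integral_bounded_kernel[OF w zero_less_one,
        where b = "c * B0" and k' = "\<lambda>s y h. ?d s y * h" and B = "c * B1"])
    show "?k s \<in> borel_measurable lborel" for s
      by (rule borel_measurable_scaled[OF smooth_continuous[OF F(1)]])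
    show "\<bar>?k s y\<bar> \<le> c * B0" if "s \<in> ball t 1" for s y
      using B0(2) c[OF that] by (auto simp: abs_mult c_def intro!: mult_mono)
    show "((\<lambda>s. ?k s y) has_derivative (\<lambda>h. ?d s y * h)) (at s)" for s y
      using deriv unfolding has_field_derivative_def by blast
    show "\<bar>?d s y * h\<bar> \<le> c * B1 * norm h" if "s \<in> ball t 1" for s y h
    proof -
      have "\<bar>?d s y\<bar> = exp (m * s) * (\<bar>laplacian P (exp s *\<^sub>R (x - y))\<bar> / 2)" by (simp add: abs_mult)
      also have "\<dots> \<le> c * B1" using c[OF that] B1(2)[of "exp s *\<^sub>R (x - y)"] B1(1) 
        by (intro mult_mono) (auto simp: c_def)
      finally have "\<bar>?d s y\<bar> * \<bar>h\<bar> \<le> c * B1 * \<bar>h\<bar>" by (rule mult_right_mono) simp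
      then show ?thesis by (simp only: abs_mult real_norm_def)
    qed
    show "(\<lambda>y. ?d t y * h) \<in> borel_measurable lborel" for h
      using borel_measurable_scaled[OF continuous_laplacian[OF P(1)], of "exp (m * t)" "exp t" x]
      by simp
  qed
  moreover have "(\<integral>y. w y * (?d t y * h) \<partial>lborel) = ((- 1 / 2) * mollify m (laplacian P) w t x) * h" for h
  proof -
    have "(\<integral>y. w y * (?d t y * h) \<partial>lborel)
      = (\<integral>y. (- h / 2) * (w y * (exp (m * t) * laplacian P (exp t *\<^sub>R (x - y)))) \<partial>lborel)"
      by (intro Bochner_Integration.integral_cong) auto
    then show ?thesis by (simp only: integral_mult_right_zero mollify_def) simp
  qed
  ultimately have "((\<lambda>s. mollify m F w s x) has_derivative
      (\<lambda>h. ((- 1 / 2) * mollify m (laplacian P) w t x) * h)) (at t)"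
    by (simp only: mollify_def)
  then show ?thesis unfolding has_field_derivative_def .
qed

lemma smooth_inner_radial: "smooth (\<lambda>z::'a::euclidean_space. (z \<bullet> a) * radial j z)"
  by (intro smooth_mult smooth_inner smooth_radial)

lemma radial_bounded: "\<exists>B>0. \<forall>z::'a::euclidean_space. \<bar>radial j z\<bar> \<le> B"
  by (rule bounded_of_compact_support[OF smooth_continuous[OF smooth_radial]]) (simp add: radial_eq_0)

lemma inner_radial_bound:
  assumes "\<And>z::'a::euclidean_space. \<bar>radial j z\<bar> \<le> B"
  shows "\<bar>((z::'a) \<bullet> a) * radial j z\<bar> \<le> norm a * B"
proof (cases "norm z \<ge> 1")
  case True
  moreover have "0 \<le> B" using assms[of 0] by linarith
  ultimately show ?thesis by (simp add: radial_eq_0)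
next
  case False
  have "\<bar>z \<bullet> a\<bar> \<le> norm z * norm a" by (rule Cauchy_Schwarz_ineq2)
  also have "\<dots> \<le> norm a" using False by (simp add: mult_left_le_one_le)
  finally show ?thesis unfolding abs_mult using assms[of z] by (intro mult_mono) auto
qed

text \<open>The inner derivative contributes exp t, hence the exponent m + 1; the gradient of the
  profile contributes -2 and the next index.\<close>

lemma mollify_has_derivative:
  fixes w :: "'a::euclidean_space \<Rightarrow> real"
  assumes w: "integrable lborel w"
  shows "(mollify m (radial j) w t has_derivative
    (\<lambda>h. - 2 * mollify (m + 1) (\<lambda>z. (z \<bullet> h) * radial (Suc j) z) w t x)) (at x)"
proof -
  obtain B0 where B0: "B0 > 0" "\<And>z::'a. \<bar>radial j z\<bar> \<le> B0" using radial_bounded by blast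
  obtain B1 where B1: "B1 > 0" "\<And>z::'a. \<bar>radial (Suc j) z\<bar> \<le> B1" using radial_bounded by blast
  have e: "exp ((m + 1) * t) = exp (m * t) * exp t" by (simp add: distrib_right exp_add)
  let ?F = "\<lambda>h z::'a. (z \<bullet> h) * radial (Suc j) z"
  let ?k = "\<lambda>(x::'a) y. exp (m * t) * radial j (exp t *\<^sub>R (x - y))"
  let ?d = "\<lambda>x y h. - 2 * exp ((m + 1) * t) * ?F h (exp t *\<^sub>R (x - y))"
  have "((\<lambda>x. \<integral>y. w y * ?k x y \<partial>lborel) has_derivative (\<lambda>h. \<integral>y. w y * ?d x y h \<partial>lborel)) (at x)"
  proof (rule has_derivative_integral_bounded_kernel[OF w zero_less_one,
        where b = "exp (m * t) * B0" and k' = ?d and B = "2 * exp ((m + 1) * t) * B1"])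
    show "?k x \<in> borel_measurable lborel" for x
      by (rule borel_measurable_scaled[OF smooth_continuous[OF smooth_radial]])
    show "\<bar>?k x y\<bar> \<le> exp (m * t) * B0" for x y using B0(2) by (simp add: abs_mult)
    show "((\<lambda>x. ?k x y) has_derivative ?d x y) (at x)" for x y
    proof -
      have "((\<lambda>x. ?k x y) has_derivative
          (\<lambda>h. exp (m * t) * ((exp t *\<^sub>R h) \<bullet> ((- 2 * radial (Suc j) (exp t *\<^sub>R (x - y))) *\<^sub>R (exp t *\<^sub>R (x - y)))))) (at x)"
        by (intro has_derivative_mult_right
            has_derivative_compose[OF _ GDERIV_radial[unfolded gderiv_def], where f = "\<lambda>x. exp t *\<^sub>R (x - y)"])
           (auto intro!: derivative_eq_intros)
      then show ?thesis
        by (rule has_derivative_eq_rhs) (auto simp: e[unfolded mult.commute[of _ t]] inner_commute mult_ac)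
    qed
    show "\<bar>?d z y h\<bar> \<le> 2 * exp ((m + 1) * t) * B1 * norm h" for z y h
      using inner_radial_bound[OF B1(2), of "exp t *\<^sub>R (z - y)" h]
      by (simp add: abs_mult mult_ac)
    show "(\<lambda>y. ?d x y h) \<in> borel_measurable lborel" for h
      by (rule borel_measurable_scaled[OF smooth_continuous[OF smooth_inner_radial]])
  qed
  moreover have "(\<integral>y. w y * ?d x y h \<partial>lborel) = - 2 * mollify (m + 1) (?F h) w t x" for h
  proof -
    have "(\<integral>y. w y * ?d x y h \<partial>lborel)
      = (\<integral>y. (- 2) * (w y * (exp ((m + 1) * t) * ?F h (exp t *\<^sub>R (x - y)))) \<partial>lborel)"
      by (intro Bochner_Integration.integral_cong) auto
    then show ?thesis by (simp only: integral_mult_right_zero mollify_def)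
  qed
  ultimately show ?thesis by (simp add: mollify_def[abs_def])
qed

text \<open>The rescaled kernel lives on a ball of radius exp (-t), whose volume supplies the
  exponential factor. The bound on v is asked only almost everywhere on that ball.\<close>

lemma kernel_integral_le:
  fixes x :: "'a::euclidean_space"
  assumes "\<And>z. \<bar>G z\<bar> \<le> B" "\<And>z. norm z > 1 \<Longrightarrow> G z = 0" "AE y in lborel. y \<in> cball x (exp (- t)) \<longrightarrow> \<bar>v y\<bar> \<le> M"
  shows "\<bar>\<integral>y. v y * G (exp t *\<^sub>R (x - y)) \<partial>lborel\<bar>
    \<le> M * B * unit_ball_vol (real DIM('a)) * exp (- real DIM('a) * t)"
proof -
  let ?S = "cball x (exp (- t))"
  have zero: "G (exp t *\<^sub>R (x - y)) = 0" if "y \<notin> ?S" for y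
  proof (rule assms(2))
    have "exp (- t) < norm (x - y)" using that by (simp add: dist_norm)
    then have "exp t * exp (- t) < exp t * norm (x - y)" by (rule mult_strict_left_mono) simp
    then show "1 < norm (exp t *\<^sub>R (x - y))" by (simp add: exp_minus)
  qed
  have "\<bar>\<integral>y. v y * G (exp t *\<^sub>R (x - y)) \<partial>lborel\<bar> \<le> (\<integral>y. M * B * indicator ?S y \<partial>lborel)"
  proof (rule abs_integral_le_AE)
    show "integrable lborel (\<lambda>y. M * B * indicator ?S y)"
      using emeasure_lborel_cball_finite[of x "exp (- t)"]
      by (intro integrable_mult_right integrable_real_indicator) auto
    show "AE y in lborel. \<bar>v y * G (exp t *\<^sub>R (x - y))\<bar> \<le> M * B * indicator ?S y"
      using assms(3)
    proof eventually_elim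
      case (elim y)
      show ?case
      proof (cases "y \<in> ?S")
        case True
        then have "\<bar>v y\<bar> \<le> M" using elim by blast
        then show ?thesis using True assms(1)[of "exp t *\<^sub>R (x - y)"]
          by (auto simp: abs_mult intro!: mult_mono)
      next
        case False
        then show ?thesis using zero by simp
      qed
    qed
  qed
  also have "\<dots> = M * B * measure lborel ?S" by simp
  also have "measure lborel ?S = unit_ball_vol (real DIM('a)) * exp (- t) ^ DIM('a)"
    by (simp add: content_cball)
  also have "exp (- t) ^ DIM('a) = exp (- real DIM('a) * t)"
    by (simp add: exp_of_nat_mult[symmetric])
  finally show ?thesis by (simp add: mult_ac)
qed

lemma mollify_bound:
  fixes x :: "'a::euclidean_space"
  assumes "\<And>z. \<bar>G z\<bar> \<le> B" "\<And>z. norm z > 1 \<Longrightarrow> G z = 0" "AE y in lborel. y \<in> cball x (exp (- t)) \<longrightarrow> \<bar>w y\<bar> \<le> M"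
  shows "\<bar>mollify m G w t x\<bar> \<le> M * B * unit_ball_vol (real DIM('a)) * exp ((m - real DIM('a)) * t)"
proof -
  have "mollify m G w t x = exp (m * t) * (\<integral>y. w y * G (exp t *\<^sub>R (x - y)) \<partial>lborel)"
    unfolding mollify_def by (simp only: mult.left_commute[of _ "exp (m * t)"] integral_mult_right_zero)
  then have "\<bar>mollify m G w t x\<bar> \<le> exp (m * t) * (M * B * unit_ball_vol (real DIM('a)) * exp (- real DIM('a) * t))"
    using kernel_integral_le[of G B x t w M, OF assms] by (simp add: abs_mult)
  moreover have "exp ((m - real DIM('a)) * t) = exp (m * t) * exp (- real DIM('a) * t)"
    by (simp add: exp_add[symmetric] algebra_simps)
  ultimately show ?thesis by (simp only: mult_ac)
qed

text \<open>Testing against the L^1 norm of \<zeta> is the dual form of a distributional Laplacian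
  bounded by H. Only w itself occurs, no gradient, so rescaled kernels can be inserted
  directly.\<close>

definition weakly_bounded_laplacian :: "'a::euclidean_space set \<Rightarrow> ('a \<Rightarrow> real) \<Rightarrow> real \<Rightarrow> bool" where
  "weakly_bounded_laplacian U w H \<longleftrightarrow>
     (\<forall>\<zeta>. test_function U \<zeta> \<longrightarrow> \<bar>\<integral>y. w y * laplacian \<zeta> y \<partial>lborel\<bar> \<le> H * (\<integral>y. \<bar>\<zeta> y\<bar> \<partial>lborel))"

text \<open>As a function of y, the rescaled P is a test function whose Laplacian carries the factor
  exp (2 t). Dividing by it gains two powers of the scale over the trivial bound.\<close>

lemma mollify_laplacian_bound:
  fixes x :: "'a::euclidean_space"
  assumes H: "weakly_bounded_laplacian U w H" "H \<ge> 0" and U: "cball x (exp (- t)) \<subseteq> U"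
    and P: "smooth P" "\<And>z. \<bar>P z\<bar> \<le> B" "\<And>z. norm z > 1 \<Longrightarrow> P z = 0"
  shows "\<bar>mollify m (laplacian P) w t x\<bar>
    \<le> H * B * unit_ball_vol (real DIM('a)) * exp ((m - 2 - real DIM('a)) * t)"
proof -
  define \<zeta> where "\<zeta> y = P (exp t *\<^sub>R (x - y))" for y
  have "test_function U \<zeta>"
    unfolding \<zeta>_def by (rule test_function_scaled[OF P(1,3)]) (use U in \<open>auto simp: exp_minus inverse_eq_divide\<close>)
  then have 1: "\<bar>\<integral>y. w y * laplacian \<zeta> y \<partial>lborel\<bar> \<le> H * (\<integral>y. \<bar>\<zeta> y\<bar> \<partial>lborel)"
    using H(1) by (simp add: weakly_bounded_laplacian_def)
  have "\<bar>\<integral>y. 1 * \<bar>P (exp t *\<^sub>R (x - y))\<bar> \<partial>lborel\<bar>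
      \<le> 1 * B * unit_ball_vol (real DIM('a)) * exp (- real DIM('a) * t)"
    by (rule kernel_integral_le[where G = "\<lambda>z. \<bar>P z\<bar>"]) (use P in auto)
  then have 2: "(\<integral>y. \<bar>\<zeta> y\<bar> \<partial>lborel) \<le> B * unit_ball_vol (real DIM('a)) * exp (- real DIM('a) * t)"
    by (simp add: \<zeta>_def)
  have lap: "laplacian \<zeta> y = exp (2 * t) * laplacian P (exp t *\<^sub>R (x - y))" for y
    unfolding \<zeta>_def laplacian_scaled[OF P(1)] by (simp add: exp_double)
  have "mollify m (laplacian P) w t x = exp ((m - 2) * t) * (\<integral>y. w y * laplacian \<zeta> y \<partial>lborel)"
    unfolding mollify_def lap integral_mult_right_zero[symmetric]
    by (intro Bochner_Integration.integral_cong refl)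
       (simp add: left_diff_distrib exp_diff field_simps)
  then have "\<bar>mollify m (laplacian P) w t x\<bar> = exp ((m - 2) * t) * \<bar>\<integral>y. w y * laplacian \<zeta> y \<partial>lborel\<bar>"
    by (simp add: abs_mult)
  also have "\<dots> \<le> exp ((m - 2) * t) * (H * (B * unit_ball_vol (real DIM('a)) * exp (- real DIM('a) * t)))"
    using 1 mult_left_mono[OF 2 H(2)] by (intro mult_left_mono) auto
  also have "\<dots> = H * B * unit_ball_vol (real DIM('a)) * exp ((m - 2 - real DIM('a)) * t)"
    by (simp add: exp_add[symmetric] algebra_simps)
  finally show ?thesis .
qed

section \<open>Exponential convergence as the scale tends to zero\<close>

lemma exponential_decay_Cauchy:
  fixes g :: "real \<Rightarrow> real"
  assumes "\<beta> > 0" "t \<le> t'"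
    and "\<And>s. s \<ge> t \<Longrightarrow> (g has_real_derivative g' s) (at s)"
    and "\<And>s. s \<ge> t \<Longrightarrow> \<bar>g' s\<bar> \<le> c * exp (- \<beta> * s)"
  shows "\<bar>g t' - g t\<bar> \<le> c / \<beta> * exp (- \<beta> * t)"
proof -
  have der: "((\<lambda>s. c / \<beta> * exp (- \<beta> * s)) has_real_derivative - c * exp (- \<beta> * s)) (at s)" for s
    using assms(1) by (auto intro!: derivative_eq_intros)
  have "0 \<le> c * exp (- \<beta> * t)" using assms(4)[of t] abs_ge_zero order_trans by blast
  then have "c \<ge> 0" by (simp add: zero_le_mult_iff)
  then have pos: "c / \<beta> * exp (- \<beta> * t') \<ge> 0" using assms(1) by simp
  \<comment> \<open>The derivative of c/\<beta> exp (-\<beta> s) is -c exp (-\<beta> s), which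
    dominates |g'|: adding it makes g nonincreasing, subtracting it makes g nondecreasing.\<close>
  have "g t' + c / \<beta> * exp (- \<beta> * t') \<le> g t + c / \<beta> * exp (- \<beta> * t)"
  proof (rule DERIV_nonpos_imp_nonincreasing[OF assms(2)])
    fix s assume s: "t \<le> s" "s \<le> t'"
    show "\<exists>y. ((\<lambda>s. g s + c / \<beta> * exp (- \<beta> * s)) has_real_derivative y) (at s) \<and> y \<le> 0"
      using DERIV_add[OF assms(3)[OF s(1)] der] assms(4)[OF s(1)] by (intro exI conjI) auto
  qed
  moreover have "g t - c / \<beta> * exp (- \<beta> * t) \<le> g t' - c / \<beta> * exp (- \<beta> * t')"
  proof (rule DERIV_nonneg_imp_nondecreasing[OF assms(2)])
    fix s assume s: "t \<le> s" "s \<le> t'"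
    show "\<exists>y. ((\<lambda>s. g s - c / \<beta> * exp (- \<beta> * s)) has_real_derivative y) (at s) \<and> y \<ge> 0"
      using DERIV_diff[OF assms(3)[OF s(1)] der] assms(4)[OF s(1)] by (intro exI conjI) auto
  qed
  ultimately show ?thesis using pos by linarith
qed

text \<open>The decay rate DIM + 2 - m is 2 for the mollification and 1 for its first derivatives;
  it is positive in both cases, so both converge.\<close>

lemma mollify_Cauchy:
  fixes x :: "'a::euclidean_space"
  assumes w: "integrable lborel w" and H: "weakly_bounded_laplacian U w H" "H \<ge> 0"
    and U: "cball x (exp (- t)) \<subseteq> U" and t: "t \<le> t'" and m: "m < real DIM('a) + 2"
    and F: "smooth F" "\<And>z. norm z > 1 \<Longrightarrow> F z = 0"
    and P: "smooth P" "\<And>z. \<bar>P z\<bar> \<le> B" "\<And>z. norm z > 1 \<Longrightarrow> P z = 0"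
    and eq: "\<And>z. m * F z + z \<bullet> grad F z = - laplacian P z / 2"
  shows "\<bar>mollify m F w t' x - mollify m F w t x\<bar>
    \<le> H * B * unit_ball_vol (real DIM('a)) / (2 * (real DIM('a) + 2 - m)) * exp (- (real DIM('a) + 2 - m) * t)"
proof -
  define c where "c = H * B * unit_ball_vol (real DIM('a)) / 2"
  have "\<bar>mollify m F w t' x - mollify m F w t x\<bar>
    \<le> c / (real DIM('a) + 2 - m) * exp (- (real DIM('a) + 2 - m) * t)"
  proof (rule exponential_decay_Cauchy[where g' = "\<lambda>s. (- 1 / 2) * mollify m (laplacian P) w s x"])
    show "real DIM('a) + 2 - m > 0" using m by simp
    show "((\<lambda>s. mollify m F w s x) has_real_derivative (- 1 / 2) * mollify m (laplacian P) w s x) (at s)" for s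
      by (rule mollify_DERIV_time[OF w F P(1,3) eq])
    fix s assume "t \<le> s"
    then have "cball x (exp (- s)) \<subseteq> U" using U by (meson exp_le_cancel_iff neg_le_iff_le subset_cball subset_trans)
    from mollify_laplacian_bound[OF H this P, of m]
    have "\<bar>(- 1 / 2) * mollify m (laplacian P) w s x\<bar> \<le> c * exp ((m - 2 - real DIM('a)) * s)"
      by (simp add: c_def abs_mult)
    also have "(m - 2 - real DIM('a)) * s = - (real DIM('a) + 2 - m) * s" by (simp add: algebra_simps)
    finally show "\<bar>(- 1 / 2) * mollify m (laplacian P) w s x\<bar> \<le> c * exp (- (real DIM('a) + 2 - m) * s)" .
  qed (rule t)
  then show ?thesis by (simp add: c_def)
qed

text \<open>The gradient at the fixed scale R/2 costs M/R since only the size of w enters; all finer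
  scales together change it by a multiple of H R. V is a pointwise limit on a whole smaller ball, so
  that limits obtained around different centres can be glued.\<close>

proposition gradient_estimate_ball:
  "\<exists>C\<ge>0. \<forall>(w :: 'a::euclidean_space \<Rightarrow> real) x0 R M H. integrable lborel w \<and> R > 0 \<and> H \<ge> 0
     \<and> (AE y in lborel. y \<in> ball x0 R \<longrightarrow> \<bar>w y\<bar> \<le> M) \<and> weakly_bounded_laplacian (ball x0 R) w H \<longrightarrow>
     (\<exists>V V'. (\<forall>x\<in>ball x0 (R / 2). (\<lambda>k. mollify (real DIM('a)) (radial 1) w (real k) x) \<longlonglongrightarrow> V x)
        \<and> (V has_derivative V') (at x0) \<and> (\<forall>h. \<bar>V' h\<bar> \<le> C * (M / R + H * R) * norm h))"
proof -
  define n where "n = real DIM('a)"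
  define v where "v = unit_ball_vol n"
  have v: "v > 0" by (simp add: v_def n_def unit_ball_vol_pos)
  obtain B0 where B0: "B0 > 0" "\<And>z::'a. \<bar>radial 0 z\<bar> \<le> B0" using radial_bounded by blast
  obtain B1 where B1: "B1 > 0" "\<And>z::'a. \<bar>radial 1 z\<bar> \<le> B1" using radial_bounded by blast
  obtain B2 where B2: "B2 > 0" "\<And>z::'a. \<bar>radial 2 z\<bar> \<le> B2" using radial_bounded by blast
  \<comment> \<open>The bounds below produce the coefficients 4 B2 v for M/R and B1 v / 2 for H R;
    their crude common majorant is taken.\<close>
  define C where "C = 4 * B2 * v + B1 * v"
  define F where "F h z = (z \<bullet> h) * radial 2 z" for h z :: 'a
  have F0: "F h z = 0" if "norm z > 1" for h z using that by (simp add: F_def radial_eq_0)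
  have eq0: "n * radial 1 z + z \<bullet> grad (radial 1) z = - laplacian (radial 0) z / 2" for z :: 'a
    by (simp add: grad_eq[OF GDERIV_radial] laplacian_radial n_def numeral_2_eq_2)
  have eq1: "(n + 1) * F h z + z \<bullet> grad (F h) z = - laplacian (\<lambda>z. (z \<bullet> h) * radial 1 z) z / 2" for h z
    unfolding F_def[abs_def] grad_eq[OF GDERIV_inner_radial] laplacian_inner_radial n_def
    by (simp add: inner_diff_right numeral_2_eq_2 field_simps)
  show ?thesis
  proof (intro exI[of _ C] conjI allI impI)
    show "C \<ge> 0" using v B1(1) B2(1) by (simp add: C_def)
    fix w :: "'a \<Rightarrow> real" and x0 R M H
    assume asm: "integrable lborel w \<and> R > 0 \<and> H \<ge> 0
     \<and> (AE y in lborel. y \<in> ball x0 R \<longrightarrow> \<bar>w y\<bar> \<le> M) \<and> weakly_bounded_laplacian (ball x0 R) w H"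
    then have w: "integrable lborel w" and R: "R > 0" and H: "weakly_bounded_laplacian (ball x0 R) w H" "H \<ge> 0"
      and M: "AE y in lborel. y \<in> ball x0 R \<longrightarrow> \<bar>w y\<bar> \<le> M" by auto
    \<comment> \<open>The starting scale exp (-t0) = R/2, at which the closed kernel ball around
      \<open>x0\<close> still fits into the open ball of radius R.\<close>
    define t0 where "t0 = - ln (R / 2)"
    have t0: "exp (- t0) = R / 2" "exp t0 = 2 / R" using R by (simp_all add: t0_def exp_minus)
    let ?D = "\<lambda>t x h. - 2 * mollify (n + 1) (F h) w t x"
    have inside: "cball x (exp (- t)) \<subseteq> ball x0 R" if "dist x0 x + exp (- t) < R" for x t
    proof
      fix y assume "y \<in> cball x (exp (- t))"
      then show "y \<in> ball x0 R" using that dist_triangle[of x0 y x] by simp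
    qed
    have Cauchy0: "\<bar>mollify n (radial 1) w t' x - mollify n (radial 1) w t x\<bar> \<le> H * B0 * v / 4 * exp (- 2 * t)"
      if "dist x0 x + exp (- t) < R" "t \<le> t'" for x t t'
    proof -
      have "\<bar>mollify n (radial 1) w t' x - mollify n (radial 1) w t x\<bar>
        \<le> H * B0 * unit_ball_vol (real DIM('a)) / (2 * (real DIM('a) + 2 - n))
          * exp (- (real DIM('a) + 2 - n) * t)"
        by (rule mollify_Cauchy[OF w H inside[OF that(1)] that(2) _ smooth_radial _ smooth_radial B0(2)])
           (auto simp: radial_eq_0 eq0 n_def[symmetric] simp del: One_nat_def)
      then show ?thesis by (simp add: n_def v_def)
    qed
    have Cauchy1: "\<bar>?D t' x h - ?D t x h\<bar> \<le> H * B1 * v * exp (- t) * norm h"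
      if "dist x0 x + exp (- t) < R" "t \<le> t'" for x t t' h
    proof -
      have "\<bar>mollify (n + 1) (F h) w t' x - mollify (n + 1) (F h) w t x\<bar>
        \<le> H * (norm h * B1) * unit_ball_vol (real DIM('a)) / (2 * (real DIM('a) + 2 - (n + 1)))
          * exp (- (real DIM('a) + 2 - (n + 1)) * t)"
      proof (rule mollify_Cauchy[OF w H inside[OF that(1)] that(2)])
        show "n + 1 < real DIM('a) + 2" by (simp add: n_def)
        show "smooth (F h)" unfolding F_def[abs_def] by (rule smooth_inner_radial)
        show "smooth (\<lambda>z::'a. (z \<bullet> h) * radial 1 z)" by (rule smooth_inner_radial)
        show "\<bar>(z \<bullet> h) * radial 1 z\<bar> \<le> norm h * B1" for z :: 'a by (rule inner_radial_bound[OF B1(2)])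
      qed (auto simp: F0 radial_eq_0 eq1)
      then have "\<bar>mollify (n + 1) (F h) w t' x - mollify (n + 1) (F h) w t x\<bar>
        \<le> H * B1 * v * exp (- t) * norm h / 2" by (simp add: n_def v_def mult_ac)
      then show ?thesis unfolding abs_le_iff by linarith
    qed
    have D0: "\<bar>?D t0 x0 h\<bar> \<le> 2 * (M * (norm h * B2) * v * (2 / R))" for h
    proof -
      have "\<bar>mollify (n + 1) (F h) w t0 x0\<bar> \<le> M * (norm h * B2) * unit_ball_vol (real DIM('a)) * exp ((n + 1 - real DIM('a)) * t0)"
      proof (rule mollify_bound)
        show "\<bar>F h z\<bar> \<le> norm h * B2" for z unfolding F_def by (rule inner_radial_bound[OF B2(2)])
        show "AE y in lborel. y \<in> cball x0 (exp (- t0)) \<longrightarrow> \<bar>w y\<bar> \<le> M"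
          using M
        proof eventually_elim
          case (elim y)
          show ?case
          proof
            assume "y \<in> cball x0 (exp (- t0))"
            then have "y \<in> ball x0 R" using R by (simp add: t0)
            then show "\<bar>w y\<bar> \<le> M" using elim by blast
          qed
        qed
      qed (rule F0)
      then show ?thesis by (simp add: n_def v_def t0 abs_mult)
    qed
    have der: "(mollify n (radial 1) w t has_derivative ?D t x) (at x)" for t x
      using mollify_has_derivative[OF w, of n 1 t x] by (simp add: F_def[abs_def] numeral_2_eq_2)
    have exp0: "(\<lambda>k. c * exp (- real k)) \<longlonglongrightarrow> 0" for c
    proof -
      have "(\<lambda>k. exp (- 1 :: real) ^ k) \<longlonglongrightarrow> 0" by (rule LIMSEQ_realpow_zero) auto
      then show ?thesis
        by (intro tendsto_mult_right_zero) (simp add: exp_of_nat_mult[symmetric])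
    qed
    \<comment> \<open>From index N on, the kernel ball around any point of the half ball stays
      inside the ball of radius R.\<close>
    obtain N where N: "\<And>k. k \<ge> N \<Longrightarrow> exp (- real k) < R / 2"
      using order_tendstoD(2)[OF exp0[of 1], of "R / 2"] R by (auto simp: eventually_sequentially)
    define S where "S = ball x0 (R / 2)"
    have S: "dist x0 x + exp (- real k) < R" if "x \<in> S" "k \<ge> N" for x k
      using that N[of k] by (simp add: S_def)
    have Cauchy_seq: "\<exists>l. (\<lambda>k. g (real k)) \<longlonglongrightarrow> l"
      if "\<And>k k'. k \<ge> N \<Longrightarrow> k \<le> k' \<Longrightarrow> \<bar>g (real k') - g (real k)\<bar> \<le> c * exp (- real k)" for g :: "real \<Rightarrow> real" and c
    proof -
      have "Cauchy (\<lambda>k. g (real k))"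
      proof (rule metric_CauchyI)
        fix e :: real assume "e > 0"
        then obtain K where K: "\<And>k. k \<ge> K \<Longrightarrow> c * exp (- real k) < e / 2"
          using order_tendstoD(2)[OF exp0[of c], of "e / 2"] by (auto simp: eventually_sequentially)
        show "\<exists>K. \<forall>m\<ge>K. \<forall>n\<ge>K. dist (g (real m)) (g (real n)) < e"
        proof (intro exI[of _ "max K N"] allI impI)
          fix m n assume "max K N \<le> m" "max K N \<le> n"
          then have "\<bar>g (real m) - g (real (max K N))\<bar> < e / 2" "\<bar>g (real n) - g (real (max K N))\<bar> < e / 2"
            using that[of "max K N" m] that[of "max K N" n] K[of "max K N"] by (auto simp del: of_nat_max)
          then show "dist (g (real m)) (g (real n)) < e" unfolding dist_real_def by linarith
        qed
      qed
      then show ?thesis using Cauchy_convergent_iff convergent_def by blast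
    qed
    \<comment> \<open>Convergence of the values is required at a single point; on the rest of S it
      follows from uniform convergence of the derivatives.\<close>
    have "\<exists>l. (\<lambda>k. mollify n (radial 1) w (real k) x0) \<longlonglongrightarrow> l"
    proof (rule Cauchy_seq)
      fix k k' :: nat assume k: "k \<ge> N" "k \<le> k'"
      have "\<bar>mollify n (radial 1) w (real k') x0 - mollify n (radial 1) w (real k) x0\<bar> \<le> H * B0 * v / 4 * exp (- 2 * real k)"
        using k R S[of x0 k] by (intro Cauchy0) (auto simp: S_def)
      also have "\<dots> \<le> H * B0 * v / 4 * exp (- real k)"
        using H(2) B0(1) v by (intro mult_left_mono) auto
      finally show "\<bar>mollify n (radial 1) w (real k') x0 - mollify n (radial 1) w (real k) x0\<bar> \<le> H * B0 * v / 4 * exp (- real k)" .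
    qed
    then obtain l where l: "(\<lambda>k. mollify n (radial 1) w (real k) x0) \<longlonglongrightarrow> l" by blast
    have D_Cauchy: "\<bar>?D (real k') x h - ?D (real k) x h\<bar> \<le> (H * B1 * v * norm h) * exp (- real k)"
      if "x \<in> S" "k \<ge> N" "k \<le> k'" for x h k k'
      using Cauchy1[OF S[OF that(1,2)], of "real k'" h] that(3) by (simp add: mult_ac)
    have "\<forall>x h. \<exists>d. x \<in> S \<longrightarrow> (\<lambda>k. ?D (real k) x h) \<longlonglongrightarrow> d"
      using Cauchy_seq[where g = "\<lambda>t. ?D t _ _"] D_Cauchy by blast
    then obtain V' where V': "\<And>x h. x \<in> S \<Longrightarrow> (\<lambda>k. ?D (real k) x h) \<longlonglongrightarrow> V' x h" by metis
    have V'_rate: "\<bar>?D (real k) x h - V' x h\<bar> \<le> H * B1 * v * norm h * exp (- real k)"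
      if "x \<in> S" "k \<ge> N" for x h k
    proof (rule tendsto_upperbound)
      show "(\<lambda>k'. \<bar>?D (real k) x h - ?D (real k') x h\<bar>) \<longlonglongrightarrow> \<bar>?D (real k) x h - V' x h\<bar>"
        by (intro tendsto_intros V' that)
      show "\<forall>\<^sub>F k' in sequentially. \<bar>?D (real k) x h - ?D (real k') x h\<bar> \<le> H * B1 * v * norm h * exp (- real k)"
        using D_Cauchy[OF that] by (auto simp: eventually_sequentially abs_minus_commute intro!: exI[of _ k])
    qed simp
    have "\<exists>V. \<forall>x\<in>S. (\<lambda>k. mollify n (radial 1) w (real k) x) \<longlonglongrightarrow> V x \<and> (V has_derivative V' x) (at x within S)"
    proof (rule has_derivative_sequence)
      show "convex S" by (simp add: S_def)
      show "(mollify n (radial 1) w (real k) has_derivative ?D (real k) x) (at x within S)" for k x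
        using der has_derivative_at_withinI by blast
      show "\<forall>\<^sub>F k in sequentially. \<forall>x\<in>S. \<forall>h. norm (?D (real k) x h - V' x h) \<le> e * norm h" if "e > 0" for e
      proof -
        have "\<forall>\<^sub>F k in sequentially. H * B1 * v * exp (- real k) < e"
          using order_tendstoD(2)[OF exp0 that] .
        then show ?thesis using eventually_ge_at_top[of N]
        proof eventually_elim
          case (elim k)
          show ?case
          proof (intro ballI allI)
            fix x h assume "x \<in> S"
            from V'_rate[OF this elim(2), of h]
            have "norm (?D (real k) x h - V' x h) \<le> (H * B1 * v * exp (- real k)) * norm h"
              by (simp add: mult_ac)
            also have "\<dots> \<le> e * norm h" using elim(1) by (intro mult_right_mono) auto
            finally show "norm (?D (real k) x h - V' x h) \<le> e * norm h" .
          qed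
        qed
      qed
      show "x0 \<in> S" using R by (simp add: S_def)
    qed (rule l)
    then obtain V where V: "\<And>x. x \<in> S \<Longrightarrow> (\<lambda>k. mollify n (radial 1) w (real k) x) \<longlonglongrightarrow> V x"
      and dV: "\<And>x. x \<in> S \<Longrightarrow> (V has_derivative V' x) (at x within S)" by blast
    have x0: "x0 \<in> S" using R by (simp add: S_def)
    have "(V has_derivative V' x0) (at x0)"
      using dV[OF x0] x0 by (simp add: S_def at_within_open[OF _ open_ball])
    moreover have "\<bar>V' x0 h\<bar> \<le> C * (M / R + H * R) * norm h" for h
    proof -
      \<comment> \<open>A ball of positive measure carries |w| <= M almost everywhere. The sign is
        needed to enlarge the coefficient of M/R to C.\<close>
      have "0 \<le> M"
      proof (rule ccontr)
        assume "\<not> 0 \<le> M"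
        from M have "AE y in lborel. y \<notin> ball x0 R"
        proof eventually_elim
          case (elim y)
          then show ?case using \<open>\<not> 0 \<le> M\<close> by auto
        qed
        then have "emeasure lborel (ball x0 R) = 0"
          by (subst (asm) AE_iff_measurable[where N = "ball x0 R"]) auto
        then have "measure lborel (ball x0 R) = 0" by (simp add: measure_def)
        then show False using R content_ball_gt_0_iff[of x0 R] by linarith
      qed
      obtain j where j: "t0 \<le> real j" by (meson real_arch_simple)
      have "\<bar>V' x0 h\<bar> \<le> 2 * (M * (norm h * B2) * v * (2 / R)) + H * B1 * v * (R / 2) * norm h"
      proof (rule tendsto_upperbound)
        show "(\<lambda>k. \<bar>?D (real k) x0 h\<bar>) \<longlonglongrightarrow> \<bar>V' x0 h\<bar>" by (intro tendsto_intros V' x0)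
        have "\<bar>?D (real k) x0 h\<bar> \<le> 2 * (M * (norm h * B2) * v * (2 / R)) + H * B1 * v * (R / 2) * norm h"
          if "k \<ge> j" for k
        proof -
          have "t0 \<le> real k" using j that by linarith
          then have "\<bar>?D (real k) x0 h - ?D t0 x0 h\<bar> \<le> H * B1 * v * exp (- t0) * norm h"
            using R by (intro Cauchy1) (auto simp: t0)
          then show ?thesis using D0[of h] unfolding t0 by linarith
        qed
        then show "\<forall>\<^sub>F k in sequentially. \<bar>?D (real k) x0 h\<bar> \<le> 2 * (M * (norm h * B2) * v * (2 / R)) + H * B1 * v * (R / 2) * norm h"
          by (auto simp: eventually_sequentially)
      qed simp
      also have "\<dots> = (4 * B2 * v * (M / R) + (B1 * v / 2) * (H * R)) * norm h"
        using R by (simp add: field_simps)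
      also have "\<dots> \<le> (C * (M / R) + C * (H * R)) * norm h"
        using v B1(1) B2(1) \<open>0 \<le> M\<close> R H(2)
        by (intro mult_right_mono add_mono) (auto simp: C_def)
      finally show ?thesis by (simp add: distrib_left)
    qed
    ultimately show "\<exists>V V'. (\<forall>x\<in>ball x0 (R / 2). (\<lambda>k. mollify (real DIM('a)) (radial 1) w (real k) x) \<longlonglongrightarrow> V x)
        \<and> (V has_derivative V') (at x0) \<and> (\<forall>h. \<bar>V' h\<bar> \<le> C * (M / R + H * R) * norm h)"
      using V unfolding S_def n_def by blast
  qed
qed

subsection \<open>Approximate identities\<close>

lemma nn_integral_lborel_affine:
  fixes t :: "'a::euclidean_space"
  assumes [measurable]: "f \<in> borel_measurable borel" and c: "c \<noteq> 0"
  shows "(\<integral>\<^sup>+ x. f x \<partial>lborel) = ennreal (\<bar>c\<bar> ^ DIM('a)) * (\<integral>\<^sup>+ x. f (t + c *\<^sub>R x) \<partial>lborel)"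
  by (subst lborel_affine[OF c, of t])
     (simp add: nn_integral_density nn_integral_distr nn_integral_cmult)

definition bump_kernel :: "real \<Rightarrow> 'a::euclidean_space \<Rightarrow> 'a \<Rightarrow> real" where
  "bump_kernel t x y = exp (real DIM('a) * t) * radial 1 (exp t *\<^sub>R (x - y))"

text \<open>The kernels are left unnormalized to keep the derivative relations between the profiles
  free of constants; the mass is divided out once, when the representative of u is defined.\<close>

definition bump_mass :: "'a::euclidean_space itself \<Rightarrow> real" where
  "bump_mass _ = (\<integral>z. radial 1 (z::'a) \<partial>lborel)"

lemma mollify_eq_bump: "mollify (real DIM('a)) (radial 1) w t (x::'a::euclidean_space) = (\<integral>y. w y * bump_kernel t x y \<partial>lborel)"
  by (simp add: mollify_def bump_kernel_def)

lemma bump_kernel_nonneg: "bump_kernel t x y \<ge> 0"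
  unfolding bump_kernel_def by (intro mult_nonneg_nonneg radial_1_nonneg) simp

lemma bump_kernel_eq_0:
  assumes "dist x y \<ge> exp (- t)" shows "bump_kernel t x y = 0"
proof -
  have "exp t * exp (- t) \<le> exp t * dist x y" using assms by (intro mult_left_mono) auto
  then have "norm (exp t *\<^sub>R (x - y)) \<ge> 1" by (simp add: exp_minus dist_norm)
  then show ?thesis unfolding bump_kernel_def by (simp only: radial_eq_0)
qed

lemma continuous_bump_kernel: "continuous_on UNIV (\<lambda>(x, y). bump_kernel t x (y::'a::euclidean_space))"
  unfolding bump_kernel_def case_prod_unfold
  by (intro continuous_intros continuous_on_compose2[OF smooth_continuous[OF smooth_radial]]) auto

lemma measurable_bump_kernel [measurable]:
  "(\<lambda>(x, y). bump_kernel t x (y::'a::euclidean_space)) \<in> borel_measurable (borel \<Otimes>\<^sub>M borel)"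
  using borel_measurable_continuous_onI[OF continuous_bump_kernel] by (simp add: borel_prod)

lemma measurable_bump_kernel_snd [measurable]:
  "bump_kernel t x \<in> borel_measurable borel" for x :: "'a::euclidean_space"
  by measurable

lemma integrable_radial: "integrable lborel (radial j :: 'a::euclidean_space \<Rightarrow> real)"
proof -
  have "integrable lborel (\<lambda>z::'a. indicator (cball 0 1) z *\<^sub>R radial j z)"
    by (intro borel_integrable_compact smooth_continuous smooth_radial) simp
  also have "(\<lambda>z::'a. indicator (cball 0 1) z *\<^sub>R radial j z) = radial j"
    by (auto simp: fun_eq_iff indicator_def radial_eq_0)
  finally show ?thesis .
qed

lemma bump_mass_pos: "bump_mass TYPE('a::euclidean_space) > 0"
proof -
  have "(\<integral>z. radial 1 (z::'a) \<partial>lborel) \<noteq> 0"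
  proof
    assume "(\<integral>z. radial 1 (z::'a) \<partial>lborel) = 0"
    then have "AE z::'a in lborel. radial 1 z = 0"
      by (subst (asm) integral_nonneg_eq_0_iff_AE[OF integrable_radial]) (auto simp: radial_1_nonneg simp del: One_nat_def)
    then have "AE z::'a in lborel. z \<notin> ball 0 1"
    proof eventually_elim
      case (elim z)
      then show ?case using radial_1_pos[of z] by auto
    qed
    then have "emeasure lborel (ball (0::'a) 1) = 0"
      by (subst (asm) AE_iff_measurable[where N = "ball 0 1"]) auto
    then have "measure lborel (ball (0::'a) 1) = 0" by (simp add: measure_def)
    then show False using content_ball_gt_0_iff[of "0::'a" 1] by linarith
  qed
  moreover have "(\<integral>z. radial 1 (z::'a) \<partial>lborel) \<ge> 0"
    by (intro integral_nonneg_AE) (auto simp: radial_1_nonneg simp del: One_nat_def)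
  ultimately show ?thesis unfolding bump_mass_def by linarith
qed

lemma nn_integral_radial: "(\<integral>\<^sup>+ z. radial 1 (z::'a::euclidean_space) \<partial>lborel) = bump_mass TYPE('a)"
  unfolding bump_mass_def
  by (intro nn_integral_eq_integral integrable_radial) (auto simp: radial_1_nonneg simp del: One_nat_def)

text \<open>Both marginals reduce to an affine substitution of factor -exp t or exp t. The
  y-marginal gives the limit on continuous functions, the x-marginal the uniform L^1 bound.\<close>

lemma nn_integral_bump_kernel:
  fixes x y :: "'a::euclidean_space"
  shows "(\<integral>\<^sup>+ y. bump_kernel t x y \<partial>lborel) = bump_mass TYPE('a)"
    and "(\<integral>\<^sup>+ x. bump_kernel t x y \<partial>lborel) = bump_mass TYPE('a)"
proof -
  have meas: "(\<lambda>z::'a. ennreal (radial 1 z)) \<in> borel_measurable borel"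
    using integrable_radial[of 1, where ?'a = 'a] by measurable
  have e: "exp t ^ DIM('a) = exp (real DIM('a) * t)" by (simp add: exp_of_nat_mult)
  have m: "(\<lambda>y. ennreal (radial 1 (a + c *\<^sub>R y))) \<in> borel_measurable lborel" for a :: 'a and c
    using measurable_compose[OF _ meas, of "\<lambda>y. a + c *\<^sub>R y" lborel] by simp
  have *: "(\<integral>\<^sup>+ y. exp (real DIM('a) * t) * radial 1 (a + c *\<^sub>R y) \<partial>lborel) = bump_mass TYPE('a)"
    if "\<bar>c\<bar> = exp t" for a :: 'a and c
  proof -
    have "c \<noteq> 0" using that by auto
    from nn_integral_lborel_affine[OF meas this, of a] show ?thesis
      unfolding that e nn_integral_radial using m[of a c]
      by (simp add: ennreal_mult radial_1_nonneg nn_integral_cmult del: One_nat_def)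
  qed
  show "(\<integral>\<^sup>+ y. bump_kernel t x y \<partial>lborel) = bump_mass TYPE('a)"
    using *[of "- exp t" "exp t *\<^sub>R x"] by (simp add: bump_kernel_def algebra_simps)
  show "(\<integral>\<^sup>+ x. bump_kernel t x y \<partial>lborel) = bump_mass TYPE('a)"
    using *[of "exp t" "- exp t *\<^sub>R y"] by (simp add: bump_kernel_def algebra_simps)
qed

lemma bump_kernel_integral:
  fixes x :: "'a::euclidean_space"
  shows "has_bochner_integral lborel (bump_kernel t x) (bump_mass TYPE('a))"
  using bump_mass_pos[where ?'a = 'a] nn_integral_bump_kernel(1)[of t x]
  by (intro has_bochner_integral_nn_integral) (auto simp: bump_kernel_nonneg)

lemma bump_kernel_bounded: "\<exists>B. \<forall>x y :: 'a::euclidean_space. \<bar>bump_kernel t x y\<bar> \<le> B"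
proof -
  obtain B where "\<And>z::'a. \<bar>radial 1 z\<bar> \<le> B" using radial_bounded by blast
  then have "\<bar>bump_kernel t x y\<bar> \<le> exp (real DIM('a) * t) * B" for x y :: 'a
    unfolding bump_kernel_def abs_mult by (intro mult_mono) auto
  then show ?thesis by blast
qed

lemma integrable_mult_bump_kernel:
  fixes x :: "'a::euclidean_space"
  assumes "integrable lborel w"
  shows "integrable lborel (\<lambda>y. w y * bump_kernel t x y)"
proof -
  obtain B where "\<And>x y :: 'a. \<bar>bump_kernel t x y\<bar> \<le> B" using bump_kernel_bounded by blast
  then show ?thesis by (intro integrable_mult_bounded[OF assms]) auto
qed

lemma mollify_near_continuous:
  fixes \<phi> :: "'a::euclidean_space \<Rightarrow> real"
  assumes \<phi>: "integrable lborel \<phi>" and near: "\<And>y. dist x y \<le> exp (- t) \<Longrightarrow> \<bar>\<phi> y - \<phi> x\<bar> \<le> e"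
  shows "\<bar>(\<integral>y. \<phi> y * bump_kernel t x y \<partial>lborel) - bump_mass TYPE('a) * \<phi> x\<bar> \<le> e * bump_mass TYPE('a)"
proof -
  note K = bump_kernel_integral[of t x, unfolded has_bochner_integral_iff]
  have "(\<integral>y. \<phi> y * bump_kernel t x y \<partial>lborel) - bump_mass TYPE('a) * \<phi> x
    = (\<integral>y. \<phi> y * bump_kernel t x y - \<phi> x * bump_kernel t x y \<partial>lborel)"
    using K integrable_mult_bump_kernel[OF \<phi>] by simp
  also have "\<bar>\<dots>\<bar> \<le> (\<integral>y. e * bump_kernel t x y \<partial>lborel)"
  proof (rule abs_integral_le_AE)
    show "integrable lborel (\<lambda>y. e * bump_kernel t x y)" using K by simp
    have "\<bar>\<phi> y * bump_kernel t x y - \<phi> x * bump_kernel t x y\<bar> \<le> e * bump_kernel t x y" for y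
    proof (cases "dist x y \<le> exp (- t)")
      case True
      have "\<bar>\<phi> y - \<phi> x\<bar> * bump_kernel t x y \<le> e * bump_kernel t x y"
        using near[OF True] bump_kernel_nonneg by (rule mult_right_mono)
      then show ?thesis by (simp add: left_diff_distrib[symmetric] abs_mult bump_kernel_nonneg)
    next
      case False
      then show ?thesis by (simp add: bump_kernel_eq_0)
    qed
    then show "AE y in lborel. \<bar>\<phi> y * bump_kernel t x y - \<phi> x * bump_kernel t x y\<bar> \<le> e * bump_kernel t x y"
      by simp
  qed
  also have "\<dots> = e * bump_mass TYPE('a)" using K by simp
  finally show ?thesis .
qed

text \<open>Tonelli and the x-marginal of the kernel. It bounds mollification as an operator on L^1
  by \<open>bump_mass\<close>, uniformly in t.\<close>

lemma nn_integral_mollify_le: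
  fixes g :: "'a::euclidean_space \<Rightarrow> real"
  assumes [measurable]: "g \<in> borel_measurable borel"
  shows "(\<integral>\<^sup>+ x. (\<integral>\<^sup>+ y. ennreal (\<bar>g y\<bar> * bump_kernel t x y) \<partial>lborel) \<partial>lborel)
    = bump_mass TYPE('a) * (\<integral>\<^sup>+ y. \<bar>g y\<bar> \<partial>lborel)"
proof -
  have "(\<integral>\<^sup>+ x. (\<integral>\<^sup>+ y. ennreal (\<bar>g y\<bar> * bump_kernel t x y) \<partial>lborel) \<partial>lborel)
     = (\<integral>\<^sup>+ y. (\<integral>\<^sup>+ x. ennreal (\<bar>g y\<bar> * bump_kernel t x y) \<partial>lborel) \<partial>lborel)"
    by (rule lborel_pair.Fubini'[symmetric]) measurable
  also have "\<dots> = (\<integral>\<^sup>+ y. ennreal \<bar>g y\<bar> * (\<integral>\<^sup>+ x. bump_kernel t x y \<partial>lborel) \<partial>lborel)"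
    by (simp add: ennreal_mult bump_kernel_nonneg nn_integral_cmult)
  also have "\<dots> = bump_mass TYPE('a) * (\<integral>\<^sup>+ y. \<bar>g y\<bar> \<partial>lborel)"
    by (simp add: nn_integral_bump_kernel nn_integral_cmult mult.commute)
  finally show ?thesis .
qed

text \<open>Density argument: on the ball w is a uniformly continuous \<phi> plus a remainder small
  in L^1. Shrinking the ball to r/2 leaves room for the kernel, so an approximation inside radius r
  is enough.\<close>

lemma mollify_converges_L1:
  fixes w :: "'a::euclidean_space \<Rightarrow> real"
  assumes w: "integrable lborel w" and r: "r > 0" and \<epsilon>: "\<epsilon> > 0"
    and approx: "\<And>\<delta>. \<delta> > 0 \<Longrightarrow> \<exists>\<phi>. integrable lborel \<phi> \<and> uniformly_continuous_on UNIV \<phi> \<and>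
        (\<integral>\<^sup>+ x. ennreal (\<bar>w x - \<phi> x\<bar> * indicator (ball 0 r) x) \<partial>lborel) \<le> ennreal \<delta>"
  shows "\<forall>\<^sub>F k in sequentially. (\<integral>\<^sup>+ x. ennreal (\<bar>(\<integral>y. w y * bump_kernel (real k) x y \<partial>lborel)
      - bump_mass TYPE('a) * w x\<bar> * indicator (ball 0 (r / 2)) x) \<partial>lborel) \<le> ennreal \<epsilon>"
proof -
  define c where "c = bump_mass TYPE('a)"
  define v where "v = measure lborel (ball (0::'a) (r / 2))"
  have c: "c > 0" by (simp add: c_def bump_mass_pos)
  have v: "v > 0" using r by (simp add: v_def)
  \<comment> \<open>Three errors of size \<epsilon>/3: the mollified remainder and the remainder
    itself, at most c \<delta> each, and the oscillation of \<phi>, at most \<eta> c v with \<eta>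
    chosen below.\<close>
  define \<delta> where "\<delta> = \<epsilon> / (3 * c)"
  have \<delta>: "\<delta> > 0" using c \<epsilon> by (simp add: \<delta>_def)
  obtain \<phi> where \<phi>: "integrable lborel \<phi>" "uniformly_continuous_on UNIV \<phi>"
    and close: "(\<integral>\<^sup>+ x. ennreal (\<bar>w x - \<phi> x\<bar> * indicator (ball 0 r) x) \<partial>lborel) \<le> ennreal \<delta>"
    using approx[OF \<delta>] by blast
  note [measurable] = borel_measurable_integrable[OF w, simplified] borel_measurable_integrable[OF \<phi>(1), simplified]
  define \<eta> where "\<eta> = \<epsilon> / (3 * c * v)"
  have \<eta>: "\<eta> > 0" using c v \<epsilon> by (simp add: \<eta>_def)
  obtain d where d: "d > 0" "\<And>x y. dist y x < d \<Longrightarrow> dist (\<phi> y) (\<phi> x) < \<eta>"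
    using \<phi>(2) \<eta> unfolding uniformly_continuous_on_def by blast
  have "(\<lambda>k. exp (- 1 :: real) ^ k) \<longlonglongrightarrow> 0" by (rule LIMSEQ_realpow_zero) auto
  then have "(\<lambda>k. exp (- real k)) \<longlonglongrightarrow> 0" by (simp add: exp_of_nat_mult[symmetric])
  then have "\<forall>\<^sub>F k in sequentially. exp (- real k) < min d (r / 2)"
    using d(1) r by (intro order_tendstoD) auto
  then show ?thesis
  proof eventually_elim
    case (elim k)
    define g where "g y = (w y - \<phi> y) * indicator (ball 0 r) y" for y
    have [measurable]: "ball (0::'a) r \<in> sets borel" "ball (0::'a) (r / 2) \<in> sets borel" by simp_all
    have [measurable]: "g \<in> borel_measurable borel" unfolding g_def by measurable
    have gi: "integrable lborel g"
      unfolding g_def using w \<phi>(1) by (intro integrable_real_mult_indicator) auto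
    let ?K = "\<lambda>x y. bump_kernel (real k) x y"
    let ?I = "indicator (ball 0 (r / 2)) :: 'a \<Rightarrow> real"
    have pw: "ennreal (\<bar>(\<integral>y. w y * ?K x y \<partial>lborel) - c * w x\<bar> * ?I x)
       \<le> (\<integral>\<^sup>+ y. ennreal (\<bar>g y\<bar> * ?K x y) \<partial>lborel) + ennreal (\<eta> * c * ?I x) + ennreal (c * \<bar>g x\<bar>)" for x
    proof (cases "x \<in> ball 0 (r / 2)")
      case True
      have xr: "x \<in> ball 0 r" using True r by simp
      \<comment> \<open>The splitting of w fails only outside the ball of radius r, where the kernel
        centred at x vanishes.\<close>
      have eq: "w y * ?K x y = g y * ?K x y + \<phi> y * ?K x y" for y
      proof (cases "y \<in> ball 0 r")
        case False
        have "norm y \<le> norm x + dist x y" using norm_triangle_sub[of y x] by (simp add: dist_norm norm_minus_commute)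
        then have "dist x y \<ge> exp (- real k)" using False True elim by auto
        then show ?thesis by (simp add: bump_kernel_eq_0)
      qed (simp add: g_def algebra_simps)
      have "(\<integral>y. w y * ?K x y \<partial>lborel) = (\<integral>y. g y * ?K x y \<partial>lborel) + (\<integral>y. \<phi> y * ?K x y \<partial>lborel)"
        unfolding eq by (intro Bochner_Integration.integral_add integrable_mult_bump_kernel gi \<phi>(1))
      moreover have "\<bar>(\<integral>y. \<phi> y * ?K x y \<partial>lborel) - c * \<phi> x\<bar> \<le> \<eta> * c"
        unfolding c_def
      proof (rule mollify_near_continuous[OF \<phi>(1)])
        fix y assume "dist x y \<le> exp (- real k)"
        then have "dist (\<phi> y) (\<phi> x) < \<eta>" using d(2)[of y x] elim by (simp add: dist_commute)
        then show "\<bar>\<phi> y - \<phi> x\<bar> \<le> \<eta>" by (simp add: dist_real_def)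
      qed
      moreover have "c * \<phi> x - c * w x = - (c * g x)" using xr by (simp add: g_def algebra_simps)
      moreover have "\<bar>c * g x\<bar> = c * \<bar>g x\<bar>" using c by (simp add: abs_mult)
      ultimately have "\<bar>(\<integral>y. w y * ?K x y \<partial>lborel) - c * w x\<bar>
          \<le> \<bar>\<integral>y. g y * ?K x y \<partial>lborel\<bar> + \<eta> * c + c * \<bar>g x\<bar>" by linarith
      then have "ennreal (\<bar>(\<integral>y. w y * ?K x y \<partial>lborel) - c * w x\<bar> * ?I x)
          \<le> ennreal (\<bar>\<integral>y. g y * ?K x y \<partial>lborel\<bar> + \<eta> * c + c * \<bar>g x\<bar>)"
        using True by (simp add: ennreal_leI)
      also have "\<dots> = ennreal \<bar>\<integral>y. g y * ?K x y \<partial>lborel\<bar> + ennreal (\<eta> * c) + ennreal (c * \<bar>g x\<bar>)"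
        using c \<eta> by simp
      also have "ennreal \<bar>\<integral>y. g y * ?K x y \<partial>lborel\<bar> \<le> (\<integral>\<^sup>+ y. ennreal (\<bar>g y\<bar> * ?K x y) \<partial>lborel)"
        using integral_norm_bound_ennreal[OF integrable_mult_bump_kernel[OF gi, of "real k" x]]
        by (simp add: abs_mult bump_kernel_nonneg)
      finally show ?thesis using True by (simp add: add_right_mono)
    qed simp
    have "(\<integral>\<^sup>+ x. ennreal (\<bar>(\<integral>y. w y * ?K x y \<partial>lborel) - c * w x\<bar> * ?I x) \<partial>lborel)
      \<le> (\<integral>\<^sup>+ x. (\<integral>\<^sup>+ y. ennreal (\<bar>g y\<bar> * ?K x y) \<partial>lborel) + ennreal (\<eta> * c * ?I x) + ennreal (c * \<bar>g x\<bar>) \<partial>lborel)"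
      by (intro nn_integral_mono pw)
    also have "\<dots> = (\<integral>\<^sup>+ x. (\<integral>\<^sup>+ y. ennreal (\<bar>g y\<bar> * ?K x y) \<partial>lborel) \<partial>lborel)
        + (\<integral>\<^sup>+ x. ennreal (\<eta> * c * ?I x) \<partial>lborel) + (\<integral>\<^sup>+ x. ennreal (c * \<bar>g x\<bar>) \<partial>lborel)"
      by (subst nn_integral_add, measurable, subst nn_integral_add) measurable
    also have "(\<integral>\<^sup>+ x. (\<integral>\<^sup>+ y. ennreal (\<bar>g y\<bar> * ?K x y) \<partial>lborel) \<partial>lborel) = c * (\<integral>\<^sup>+ y. \<bar>g y\<bar> \<partial>lborel)"
      unfolding c_def by (rule nn_integral_mollify_le) measurable
    also have "(\<integral>\<^sup>+ x. ennreal (\<eta> * c * ?I x) \<partial>lborel) = ennreal (\<eta> * c * v)"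
    proof -
      have "(\<integral>\<^sup>+ x. ennreal (\<eta> * c * ?I x) \<partial>lborel) = (\<integral>\<^sup>+ x. ennreal (\<eta> * c) * indicator (ball (0::'a) (r / 2)) x \<partial>lborel)"
        by (intro nn_integral_cong) (auto simp: indicator_def)
      also have "\<dots> = ennreal (\<eta> * c) * emeasure lborel (ball (0::'a) (r / 2))"
        by (simp add: nn_integral_cmult_indicator)
      also have "emeasure lborel (ball (0::'a) (r / 2)) = ennreal v"
        unfolding v_def by (rule emeasure_eq_ennreal_measure) (use emeasure_lborel_ball_finite[of "0::'a" "r / 2"] in auto)
      finally show ?thesis using c \<eta> v by (simp add: ennreal_mult)
    qed
    also have "(\<integral>\<^sup>+ x. ennreal (c * \<bar>g x\<bar>) \<partial>lborel) = c * (\<integral>\<^sup>+ y. \<bar>g y\<bar> \<partial>lborel)"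
      using c by (simp add: ennreal_mult nn_integral_cmult)
    also have "(\<integral>\<^sup>+ y. \<bar>g y\<bar> \<partial>lborel) = (\<integral>\<^sup>+ x. ennreal (\<bar>w x - \<phi> x\<bar> * indicator (ball 0 r) x) \<partial>lborel)"
      by (intro nn_integral_cong) (simp add: g_def abs_mult)
    also have "ennreal c * \<dots> + ennreal (\<eta> * c * v) + ennreal c * \<dots>
      \<le> ennreal c * ennreal \<delta> + ennreal (\<eta> * c * v) + ennreal c * ennreal \<delta>"
      by (intro add_mono mult_left_mono close order_refl) auto
    also have "\<dots> = ennreal (c * \<delta> + \<eta> * c * v + c * \<delta>)"
      using c \<delta> \<eta> v by (simp add: ennreal_mult[symmetric] del: ennreal_plus flip: ennreal_plus)
    also have "c * \<delta> + \<eta> * c * v + c * \<delta> = \<epsilon>"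
      using c v by (simp add: \<delta>_def \<eta>_def field_simps)
    finally show ?case by (simp add: c_def)
  qed
qed

text \<open>By Fatou the liminf of the errors has integral 0, hence vanishes almost everywhere; on S
  the errors converge, so the liminf is the actual limit. No passage to a subsequence is
  involved.\<close>

lemma mollify_limit_eq_AE:
  fixes w :: "'a::euclidean_space \<Rightarrow> real"
  assumes w: "integrable lborel w" and r: "r > 0"
    and approx: "\<And>\<delta>. \<delta> > 0 \<Longrightarrow> \<exists>\<phi>. integrable lborel \<phi> \<and> uniformly_continuous_on UNIV \<phi> \<and>
        (\<integral>\<^sup>+ x. ennreal (\<bar>w x - \<phi> x\<bar> * indicator (ball 0 r) x) \<partial>lborel) \<le> ennreal \<delta>"
    and lim: "\<And>x. x \<in> S \<Longrightarrow> (\<lambda>k. mollify (real DIM('a)) (radial 1) w (real k) x) \<longlonglongrightarrow> V x"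
    and S: "S \<subseteq> ball 0 (r / 2)"
  shows "AE x in lborel. x \<in> S \<longrightarrow> V x = bump_mass TYPE('a) * w x"
proof -
  define D where "D k x = ennreal (\<bar>mollify (real DIM('a)) (radial 1) w (real k) x - bump_mass TYPE('a) * w x\<bar>
    * indicator (ball 0 (r / 2)) x)" for k x
  have "continuous_on UNIV (mollify (real DIM('a)) (radial 1) w t)" for t
    using mollify_has_derivative[OF w] by (meson continuous_at_imp_continuous_on has_derivative_continuous)
  then have [measurable]: "mollify (real DIM('a)) (radial 1) w t \<in> borel_measurable borel" for t
    by (rule borel_measurable_continuous_onI)
  note [measurable] = borel_measurable_integrable[OF w, simplified]
  have [measurable]: "ball (0::'a) (r / 2) \<in> sets borel" by simp
  have D_meas: "D k \<in> borel_measurable lborel" for k unfolding D_def by measurable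
  have "(\<integral>\<^sup>+ x. liminf (\<lambda>k. D k x) \<partial>lborel) \<le> ennreal \<epsilon>" if "\<epsilon> > 0" for \<epsilon>
  proof -
    have "(\<integral>\<^sup>+ x. liminf (\<lambda>k. D k x) \<partial>lborel) \<le> liminf (\<lambda>k. \<integral>\<^sup>+ x. D k x \<partial>lborel)"
      by (rule nn_integral_liminf) (rule D_meas)
    also have "\<dots> \<le> liminf (\<lambda>k::nat. ennreal \<epsilon>)"
      using mollify_converges_L1[OF w r that approx]
      by (intro Liminf_mono) (simp add: D_def mollify_eq_bump del: One_nat_def)
    also have "\<dots> = ennreal \<epsilon>" by (simp add: Liminf_const)
    finally show ?thesis .
  qed
  then have "(\<integral>\<^sup>+ x. liminf (\<lambda>k. D k x) \<partial>lborel) = 0"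
    by (metis ennreal_le_epsilon add_0 le_zero_eq)
  then have "AE x in lborel. liminf (\<lambda>k. D k x) = 0"
    by (subst (asm) nn_integral_0_iff_AE) (use D_meas in measurable)
  then show ?thesis
  proof eventually_elim
    case (elim x)
    show ?case
    proof
      assume x: "x \<in> S"
      then have "(\<lambda>k. D k x) \<longlonglongrightarrow> ennreal \<bar>V x - bump_mass TYPE('a) * w x\<bar>"
        using x S lim[OF x] unfolding D_def
        by (intro tendsto_ennrealI) (auto intro!: tendsto_intros simp: subset_eq simp del: One_nat_def)
      then have "liminf (\<lambda>k. D k x) = ennreal \<bar>V x - bump_mass TYPE('a) * w x\<bar>"
        by (intro lim_imp_Liminf) auto
      then show "V x = bump_mass TYPE('a) * w x" using elim by simp
    qed
  qed
qed

subsection \<open>Interior estimates for weak solutions\<close>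

lemma open_in_lebesgue: "open \<Omega> \<Longrightarrow> \<Omega> \<inter> space lebesgue \<in> sets lebesgue"
  by simp

lemma AE_lebesgue_on_open:
  "open \<Omega> \<Longrightarrow> (AE x in lebesgue_on \<Omega>. P x) \<longleftrightarrow> (AE x in lborel. x \<in> \<Omega> \<longrightarrow> P x)"
  by (simp add: AE_restrict_space_iff AE_completion_iff)

lemma test_functionD:
  assumes "test_function \<Omega> \<phi>"
  shows "smooth \<phi>" "continuous_on S \<phi>" "compact (closure {x. \<phi> x \<noteq> 0})" "closure {x. \<phi> x \<noteq> 0} \<subseteq> \<Omega>"
    and "x \<notin> closure {x. \<phi> x \<noteq> 0} \<Longrightarrow> \<phi> x = 0"
  using assms smooth_continuous closure_subset[of "{x. \<phi> x \<noteq> 0}"] by (auto simp: test_function_def)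

lemma test_function_mono: "test_function U \<phi> \<Longrightarrow> U \<subseteq> \<Omega> \<Longrightarrow> test_function \<Omega> \<phi>"
  by (auto simp: test_function_def)

lemma integrable_test_function:
  assumes "test_function \<Omega> \<phi>" shows "integrable lborel \<phi>"
proof -
  let ?K = "closure {x. \<phi> x \<noteq> 0}"
  have "integrable lborel (\<lambda>x. indicator ?K x *\<^sub>R \<phi> x)"
    using test_functionD[OF assms] by (intro borel_integrable_compact)
  also have "(\<lambda>x. indicator ?K x *\<^sub>R \<phi> x) = \<phi>"
  proof
    show "indicator ?K x *\<^sub>R \<phi> x = \<phi> x" for x
      using test_functionD(5)[OF assms, of x] by (cases "x \<in> ?K") simp_all
  qed
  finally show ?thesis .
qed

lemma uniformly_continuous_test_function:
  assumes "test_function \<Omega> (\<phi> :: 'a::euclidean_space \<Rightarrow> real)" shows "uniformly_continuous_on UNIV \<phi>"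
proof -
  let ?K = "closure {x. \<phi> x \<noteq> 0}"
  obtain r where r: "?K \<subseteq> ball 0 r"
    using test_functionD(3)[OF assms] compact_imp_bounded bounded_subset_ballD by blast
  have "uniformly_continuous_on (cball 0 (r + 1)) \<phi>"
    using test_functionD(2)[OF assms] by (intro compact_uniformly_continuous) auto
  show ?thesis
    unfolding uniformly_continuous_on_def
  proof (intro allI impI)
    fix e :: real assume e: "e > 0"
    then obtain d where d: "d > 0"
      "\<And>x y. x \<in> cball 0 (r + 1) \<Longrightarrow> y \<in> cball 0 (r + 1) \<Longrightarrow> dist y x < d \<Longrightarrow> dist (\<phi> y) (\<phi> x) < e"
      using \<open>uniformly_continuous_on (cball 0 (r + 1)) \<phi>\<close> unfolding uniformly_continuous_on_def by meson
    have "dist (\<phi> y) (\<phi> x) < e" if xy: "dist y x < min d 1" for x y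
    proof (cases "x \<in> ?K \<or> y \<in> ?K")
      case True
      then have "norm x < r \<or> norm y < r" using r by auto
      moreover have "norm x \<le> norm y + dist y x" "norm y \<le> norm x + dist y x"
        using norm_triangle_sub[of x y] norm_triangle_sub[of y x] by (simp_all add: dist_norm norm_minus_commute)
      ultimately have "x \<in> cball 0 (r + 1)" "y \<in> cball 0 (r + 1)" using xy by auto
      then show ?thesis using d(2) xy by simp
    next
      case False
      then have "\<phi> x = 0" "\<phi> y = 0" using test_functionD(5)[OF assms] by blast+
      then show ?thesis using e by simp
    qed
    then show "\<exists>d>0. \<forall>x\<in>UNIV. \<forall>y\<in>UNIV. dist y x < d \<longrightarrow> dist (\<phi> y) (\<phi> x) < e"
      using d(1) by (intro exI[of _ "min d 1"]) auto
  qed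
qed

lemma integrable_test_function_scaleR:
  fixes f :: "'a::euclidean_space \<Rightarrow> 'b::euclidean_space"
  assumes \<phi>: "test_function \<Omega> \<phi>" and \<Omega>: "open \<Omega>"
    and f: "\<And>K. compact K \<Longrightarrow> K \<subseteq> \<Omega> \<Longrightarrow> integrable (lebesgue_on K) f"
  shows "integrable (lebesgue_on \<Omega>) (\<lambda>x. \<phi> x *\<^sub>R f x)"
proof -
  let ?K = "closure {x. \<phi> x \<noteq> 0}"
  have K: "?K \<inter> space lebesgue \<in> sets lebesgue"
    using test_functionD(3)[OF \<phi>] by (simp add: compact_imp_closed)
  have fK: "integrable lebesgue (\<lambda>x. indicator ?K x *\<^sub>R f x)"
    using f[OF test_functionD(3,4)[OF \<phi>]] by (simp add: integrable_restrict_space[OF K])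
  have "compact (\<phi> ` ?K)"
    by (intro compact_continuous_image test_functionD(2,3)[OF \<phi>])
  then obtain B where B: "\<And>x. x \<in> ?K \<Longrightarrow> \<bar>\<phi> x\<bar> \<le> B"
    using compact_imp_bounded[of "\<phi> ` ?K"] by (auto simp: bounded_iff)
  have "integrable lebesgue (\<lambda>x. \<phi> x *\<^sub>R (indicator ?K x *\<^sub>R f x))"
  proof (rule Bochner_Integration.integrable_bound)
    show "integrable lebesgue (\<lambda>x. B *\<^sub>R (indicator ?K x *\<^sub>R f x))" by (rule integrable_scaleR_right[OF fK])
    have "\<phi> \<in> borel_measurable borel"
      using test_functionD(2)[OF \<phi>] by (rule borel_measurable_continuous_onI)
    then have "\<phi> \<in> borel_measurable lebesgue" by (simp add: measurable_completion)
    then show "(\<lambda>x. \<phi> x *\<^sub>R (indicator ?K x *\<^sub>R f x)) \<in> borel_measurable lebesgue"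
      using fK by measurable
    have "norm (\<phi> x *\<^sub>R (indicator ?K x *\<^sub>R f x)) \<le> norm (B *\<^sub>R (indicator ?K x *\<^sub>R f x))" for x
      unfolding norm_scaleR[of "\<phi> x"] norm_scaleR[of B]
      using B[of x] by (cases "x \<in> ?K") (auto intro!: mult_right_mono)
    then show "AE x in lebesgue. norm (\<phi> x *\<^sub>R (indicator ?K x *\<^sub>R f x)) \<le> norm (B *\<^sub>R (indicator ?K x *\<^sub>R f x))"
      by (rule AE_I2)
  qed
  also have "(\<lambda>x. \<phi> x *\<^sub>R (indicator ?K x *\<^sub>R f x)) = (\<lambda>x. indicator \<Omega> x *\<^sub>R (\<phi> x *\<^sub>R f x))"
  proof
    show "\<phi> x *\<^sub>R (indicator ?K x *\<^sub>R f x) = indicator \<Omega> x *\<^sub>R (\<phi> x *\<^sub>R f x)" for x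
      using test_functionD(4)[OF \<phi>] test_functionD(5)[OF \<phi>, of x] by (cases "x \<in> ?K") (simp_all add: subset_eq)
  qed
  finally show ?thesis by (simp add: integrable_restrict_space[OF open_in_lebesgue[OF \<Omega>]])
qed

lemma integral_lebesgue_on_test_function:
  assumes \<phi>: "test_function \<Omega> \<phi>" and \<Omega>: "open \<Omega>"
  shows "integrable (lebesgue_on \<Omega>) (\<lambda>x. \<bar>\<phi> x\<bar>)"
    and "(\<integral>x. \<bar>\<phi> x\<bar> \<partial>lebesgue_on \<Omega>) = (\<integral>x. \<bar>\<phi> x\<bar> \<partial>lborel)"
proof -
  have i: "integrable lborel (\<lambda>x. \<bar>\<phi> x\<bar>)" using integrable_test_function[OF \<phi>] by simp
  have e: "(\<lambda>x. indicator \<Omega> x *\<^sub>R \<bar>\<phi> x\<bar>) = (\<lambda>x. \<bar>\<phi> x\<bar>)"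
  proof
    show "indicator \<Omega> x *\<^sub>R \<bar>\<phi> x\<bar> = \<bar>\<phi> x\<bar>" for x
      using test_functionD(4)[OF \<phi>] test_functionD(5)[OF \<phi>, of x] by (cases "x \<in> closure {x. \<phi> x \<noteq> 0}") (simp_all add: subset_eq)
  qed
  show "integrable (lebesgue_on \<Omega>) (\<lambda>x. \<bar>\<phi> x\<bar>)"
    unfolding integrable_restrict_space[OF open_in_lebesgue[OF \<Omega>]] e
    using i borel_measurable_integrable[OF i] by (simp add: integrable_completion)
  show "(\<integral>x. \<bar>\<phi> x\<bar> \<partial>lebesgue_on \<Omega>) = (\<integral>x. \<bar>\<phi> x\<bar> \<partial>lborel)"
    unfolding integral_restrict_space[OF open_in_lebesgue[OF \<Omega>]] e
    using borel_measurable_integrable[OF i] by (simp add: integral_completion)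
qed

text \<open>The definition of the weak gradient is applied to each partial derivative of \<zeta>,
  itself a test function; the matching components are then summed.\<close>

lemma weak_gradient_laplacian:
  fixes u :: "'a::euclidean_space \<Rightarrow> real"
  assumes G: "weak_gradient \<Omega> u G" and \<Omega>: "open \<Omega>" and \<zeta>: "test_function \<Omega> \<zeta>"
  shows "(\<integral>x. u x * laplacian \<zeta> x \<partial>lebesgue_on \<Omega>) = - (\<integral>x. G x \<bullet> grad \<zeta> x \<partial>lebesgue_on \<Omega>)"
proof -
  let ?M = "lebesgue_on \<Omega>"
  let ?\<zeta> = "\<lambda>b x. grad \<zeta> x \<bullet> b"
  have u_loc: "integrable (lebesgue_on K) u" and G_loc: "integrable (lebesgue_on K) G"
    if "compact K" "K \<subseteq> \<Omega>" for K
    using G that by (auto simp: weak_gradient_def)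
  have int_u: "integrable ?M (\<lambda>x. u x * (grad (?\<zeta> b) x \<bullet> b'))" if "b \<in> Basis" "b' \<in> Basis" for b b'
    using integrable_test_function_scaleR[OF test_function_grad[OF test_function_grad[OF \<zeta> that(1)] that(2)] \<Omega> u_loc]
    by (simp add: mult.commute)
  have int_G: "integrable ?M (\<lambda>x. ?\<zeta> b x *\<^sub>R G x)" if "b \<in> Basis" for b
    by (rule integrable_test_function_scaleR[OF test_function_grad[OF \<zeta> that] \<Omega> G_loc])
  have int_u': "integrable ?M (\<lambda>x. u x *\<^sub>R grad (?\<zeta> b) x)" if "b \<in> Basis" for b
  proof -
    have "integrable ?M (\<lambda>x. \<Sum>b'\<in>Basis. (u x * (grad (?\<zeta> b) x \<bullet> b')) *\<^sub>R b')"
      using int_u[OF that] by (intro Bochner_Integration.integrable_sum integrable_scaleR_left) auto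
    also have "(\<lambda>x. \<Sum>b'\<in>Basis. (u x * (grad (?\<zeta> b) x \<bullet> b')) *\<^sub>R b') = (\<lambda>x. u x *\<^sub>R grad (?\<zeta> b) x)"
      by (simp only: scaleR_scaleR[symmetric] scaleR_sum_right[symmetric] euclidean_representation)
    finally show ?thesis .
  qed
  have part: "(\<integral>x. u x * (grad (?\<zeta> b) x \<bullet> b) \<partial>?M) = - (\<integral>x. ?\<zeta> b x * (G x \<bullet> b) \<partial>?M)" if b: "b \<in> Basis" for b
  proof -
    have "(\<integral>x. u x *\<^sub>R grad (?\<zeta> b) x \<partial>?M) = - (\<integral>x. ?\<zeta> b x *\<^sub>R G x \<partial>?M)"
      using G test_function_grad[OF \<zeta> b] unfolding weak_gradient_def by blast
    then have "(\<integral>x. u x *\<^sub>R grad (?\<zeta> b) x \<partial>?M) \<bullet> b = - ((\<integral>x. ?\<zeta> b x *\<^sub>R G x \<partial>?M) \<bullet> b)" by simp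
    then show ?thesis
      using int_u'[OF b] int_G[OF b] by (simp flip: integral_inner_left)
  qed
  have "(\<integral>x. u x * laplacian \<zeta> x \<partial>?M) = (\<integral>x. (\<Sum>b\<in>Basis. u x * (grad (?\<zeta> b) x \<bullet> b)) \<partial>?M)"
    by (simp add: laplacian_def sum_distrib_left)
  also have "\<dots> = (\<Sum>b\<in>Basis. \<integral>x. u x * (grad (?\<zeta> b) x \<bullet> b) \<partial>?M)"
    by (intro Bochner_Integration.integral_sum int_u)
  also have "\<dots> = - (\<Sum>b\<in>Basis. \<integral>x. ?\<zeta> b x * (G x \<bullet> b) \<partial>?M)"
    by (simp add: part sum_negf)
  also have "(\<Sum>b\<in>Basis. \<integral>x. ?\<zeta> b x * (G x \<bullet> b) \<partial>?M) = (\<integral>x. (\<Sum>b\<in>Basis. ?\<zeta> b x * (G x \<bullet> b)) \<partial>?M)"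
    using int_G integrable_inner_left[OF int_G] by (intro Bochner_Integration.integral_sum[symmetric]) auto
  also have "\<dots> = (\<integral>x. G x \<bullet> grad \<zeta> x \<partial>?M)"
    by (subst euclidean_inner) (simp add: mult.commute)
  finally show ?thesis .
qed

text \<open>On the ball 0 < u <= M and |y| >= d, so every term of the equation other than the
  Laplacian is bounded there. The two powers are estimated separately; their cancellation is not
  exploited.\<close>

lemma weak_solution_weakly_bounded_laplacian:
  fixes u w :: "'a::euclidean_space \<Rightarrow> real"
  assumes u: "weak_solution \<mu> p q \<Omega> u" and \<Omega>: "open \<Omega>" "ball x0 R \<subseteq> \<Omega>"
    and \<mu>: "\<mu> \<ge> 0" and p: "p \<ge> 0" and q: "q \<ge> 0" and d: "d > 0" "\<And>y. y \<in> ball x0 R \<Longrightarrow> d \<le> norm y"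
    and M: "M \<ge> 0" "AE y in lborel. y \<in> ball x0 R \<longrightarrow> u y \<le> M"
    and w: "w \<in> borel_measurable lborel" "AE y in lborel. y \<in> ball x0 R \<longrightarrow> w y = u y"
  shows "weakly_bounded_laplacian (ball x0 R) w (\<mu> * (M / d\<^sup>2) + (M powr p + M powr q))"
  unfolding weakly_bounded_laplacian_def
proof (intro allI impI)
  fix \<zeta> assume \<zeta>B: "test_function (ball x0 R) \<zeta>"
  let ?M = "lebesgue_on \<Omega>"
  have \<zeta>: "test_function \<Omega> \<zeta>" by (rule test_function_mono[OF \<zeta>B \<Omega>(2)])
  have off: "\<zeta> y = 0" "laplacian \<zeta> y = 0" if "y \<notin> ball x0 R" for y
    using that test_functionD(4,5)[OF \<zeta>B] laplacian_eq_0_off_support[of y \<zeta>] by blast+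
  obtain G where "H01_with_gradient \<Omega> u G" and eqn: "\<And>\<phi>. test_function \<Omega> \<phi> \<Longrightarrow>
     (\<integral>x. G x \<bullet> grad \<phi> x \<partial>?M) - \<mu> * (\<integral>x. u x * \<phi> x / (norm x)\<^sup>2 \<partial>?M)
          = (\<integral>x. (u x powr p - u x powr q) * \<phi> x \<partial>?M)"
    using u unfolding weak_solution_def by blast
  then have G: "weak_gradient \<Omega> u G" and um: "u \<in> borel_measurable ?M"
    by (auto simp: H01_with_gradient_def in_Lp_def)
  have lap_m: "laplacian \<zeta> \<in> borel_measurable borel"
    by (intro borel_measurable_continuous_onI continuous_laplacian test_functionD(1)[OF \<zeta>])
  have tri: "\<bar>- (\<mu> * a + b)\<bar> \<le> \<mu> * \<bar>a\<bar> + \<bar>b\<bar>" for a b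
    unfolding abs_minus_cancel using abs_triangle_ineq[of "\<mu> * a" b] \<mu> by (simp add: abs_mult)
  \<comment> \<open>The estimates for mollifications use Borel measure, the equation Lebesgue
    measure. Since w is Borel the two integrals agree, and u may replace w on the support of
    \<zeta>.\<close>
  have "(\<integral>y. w y * laplacian \<zeta> y \<partial>lborel) = (\<integral>y. w y * laplacian \<zeta> y \<partial>lebesgue)"
    using w(1) lap_m by (subst integral_completion) auto
  also have "\<dots> = (\<integral>y. indicator \<Omega> y *\<^sub>R (u y * laplacian \<zeta> y) \<partial>lebesgue)"
  proof (rule integral_cong_AE)
    show "(\<lambda>y. w y * laplacian \<zeta> y) \<in> borel_measurable lebesgue"
      using w(1) lap_m by (intro measurable_completion) auto
    have "laplacian \<zeta> \<in> borel_measurable ?M"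
      using lap_m by (intro measurable_restrict_space1 measurable_completion) simp
    then have "(\<lambda>y. u y * laplacian \<zeta> y) \<in> borel_measurable ?M" using um by measurable
    then show "(\<lambda>y. indicator \<Omega> y *\<^sub>R (u y * laplacian \<zeta> y)) \<in> borel_measurable lebesgue"
      by (simp add: borel_measurable_restrict_space_iff[OF open_in_lebesgue[OF \<Omega>(1)]])
    have "AE y in lborel. w y * laplacian \<zeta> y = indicator \<Omega> y *\<^sub>R (u y * laplacian \<zeta> y)"
      using w(2)
    proof eventually_elim
      case (elim y)
      then show ?case using \<Omega>(2) off[of y] by (cases "y \<in> ball x0 R") (auto simp: indicator_def)
    qed
    then show "AE y in lebesgue. w y * laplacian \<zeta> y = indicator \<Omega> y *\<^sub>R (u y * laplacian \<zeta> y)"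
      by (rule AE_completion)
  qed
  also have "\<dots> = (\<integral>y. u y * laplacian \<zeta> y \<partial>?M)"
    by (rule integral_restrict_space[OF open_in_lebesgue[OF \<Omega>(1)], symmetric])
  also have "\<dots> = - (\<mu> * (\<integral>x. u x * \<zeta> x / (norm x)\<^sup>2 \<partial>?M) + (\<integral>x. (u x powr p - u x powr q) * \<zeta> x \<partial>?M))"
    using weak_gradient_laplacian[OF G \<Omega>(1) \<zeta>] eqn[OF \<zeta>] by linarith
  finally have "(\<integral>y. w y * laplacian \<zeta> y \<partial>lborel)
    = - (\<mu> * (\<integral>x. u x * \<zeta> x / (norm x)\<^sup>2 \<partial>?M) + (\<integral>x. (u x powr p - u x powr q) * \<zeta> x \<partial>?M))" .
  then have eq: "\<bar>\<integral>y. w y * laplacian \<zeta> y \<partial>lborel\<bar>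
     \<le> \<mu> * \<bar>\<integral>x. u x * \<zeta> x / (norm x)\<^sup>2 \<partial>?M\<bar> + \<bar>\<integral>x. (u x powr p - u x powr q) * \<zeta> x \<partial>?M\<bar>"
    by (simp only: tri)
  note I = integral_lebesgue_on_test_function[OF \<zeta> \<Omega>(1)]
  have pos: "AE x in ?M. u x > 0" using u by (simp add: weak_solution_def)
  have upper: "AE x in ?M. x \<in> ball x0 R \<longrightarrow> u x \<le> M"
    unfolding AE_lebesgue_on_open[OF \<Omega>(1)] using M(2) by eventually_elim simp
  have 1: "\<bar>\<integral>x. u x * \<zeta> x / (norm x)\<^sup>2 \<partial>?M\<bar> \<le> (\<integral>x. (M / d\<^sup>2) * \<bar>\<zeta> x\<bar> \<partial>?M)"
  proof (rule abs_integral_le_AE)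
    show "AE x in ?M. \<bar>u x * \<zeta> x / (norm x)\<^sup>2\<bar> \<le> (M / d\<^sup>2) * \<bar>\<zeta> x\<bar>"
      using pos upper
    proof eventually_elim
      case (elim x)
      show ?case
      proof (cases "x \<in> ball x0 R")
        case True
        then have "u x / (norm x)\<^sup>2 \<le> M / d\<^sup>2"
          using elim d M(1) by (intro frac_le power_mono) auto
        then have "(u x / (norm x)\<^sup>2) * \<bar>\<zeta> x\<bar> \<le> (M / d\<^sup>2) * \<bar>\<zeta> x\<bar>" by (rule mult_right_mono) simp
        then show ?thesis using elim by (simp add: abs_mult)
      qed (simp add: off)
    qed
  qed (use I in simp)
  have 2: "\<bar>\<integral>x. (u x powr p - u x powr q) * \<zeta> x \<partial>?M\<bar> \<le> (\<integral>x. (M powr p + M powr q) * \<bar>\<zeta> x\<bar> \<partial>?M)"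
  proof (rule abs_integral_le_AE)
    show "AE x in ?M. \<bar>(u x powr p - u x powr q) * \<zeta> x\<bar> \<le> (M powr p + M powr q) * \<bar>\<zeta> x\<bar>"
      using pos upper
    proof eventually_elim
      case (elim x)
      show ?case
      proof (cases "x \<in> ball x0 R")
        case True
        then have "u x powr p \<le> M powr p" "u x powr q \<le> M powr q"
          using elim p q by (auto intro!: powr_mono2)
        moreover have "u x powr p \<ge> 0" "u x powr q \<ge> 0" by auto
        ultimately have "\<bar>u x powr p - u x powr q\<bar> \<le> M powr p + M powr q" unfolding abs_le_iff by linarith
        then show ?thesis unfolding abs_mult by (rule mult_right_mono) simp
      qed (simp add: off)
    qed
  qed (use I in simp)
  have "\<bar>\<integral>y. w y * laplacian \<zeta> y \<partial>lborel\<bar>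
     \<le> \<mu> * ((M / d\<^sup>2) * (\<integral>x. \<bar>\<zeta> x\<bar> \<partial>lborel)) + (M powr p + M powr q) * (\<integral>x. \<bar>\<zeta> x\<bar> \<partial>lborel)"
    using eq mult_left_mono[OF 1 \<mu>] 2 I by simp
  then show "\<bar>\<integral>y. w y * laplacian \<zeta> y \<partial>lborel\<bar>
     \<le> (\<mu> * (M / d\<^sup>2) + (M powr p + M powr q)) * (\<integral>x. \<bar>\<zeta> x\<bar> \<partial>lborel)"
    by (simp only: distrib_right mult.assoc)
qed

text \<open>The test functions of the H^1_0 closure converge in L^2; on a ball of finite volume this
  gives closeness in L^1.\<close>

lemma H01_L1_approximation:
  fixes u w :: "'a::euclidean_space \<Rightarrow> real"
  assumes H: "H01_with_gradient \<Omega> u G" and \<Omega>: "open \<Omega>" "ball 0 r \<subseteq> \<Omega>" and r: "r > 0"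
    and w: "AE y in lborel. y \<in> ball 0 r \<longrightarrow> w y = u y" and \<delta>: "\<delta> > 0"
  shows "\<exists>\<phi>. integrable lborel \<phi> \<and> uniformly_continuous_on UNIV \<phi> \<and>
        (\<integral>\<^sup>+ x. ennreal (\<bar>w x - \<phi> x\<bar> * indicator (ball 0 r) x) \<partial>lborel) \<le> ennreal \<delta>"
proof -
  let ?M = "lebesgue_on \<Omega>"
  define v where "v = measure lborel (ball (0::'a) r)"
  have v: "v > 0" using r by (simp add: v_def)
  \<comment> \<open>The inequality a <= \<tau> + a^2/\<tau> replaces Cauchy-Schwarz. With this
    \<tau> the first term integrates to \<delta>/2 over the ball, and the second is at most
    \<delta>/2 once the squared L^2 error is below \<tau> \<delta>/2.\<close>
  define \<tau> where "\<tau> = \<delta> / (2 * v)"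
  have \<tau>: "\<tau> > 0" using v \<delta> by (simp add: \<tau>_def)
  obtain \<phi> where \<phi>: "\<And>n. test_function \<Omega> (\<phi> n)"
    and lim: "(\<lambda>n. (\<integral>x. (\<phi> n x - u x)\<^sup>2 \<partial>?M) + (\<integral>x. (norm (grad (\<phi> n) x - G x))\<^sup>2 \<partial>?M)) \<longlonglongrightarrow> 0"
    using H unfolding H01_with_gradient_def by blast
  have "\<forall>\<^sub>F n in sequentially. (\<integral>x. (\<phi> n x - u x)\<^sup>2 \<partial>?M) + (\<integral>x. (norm (grad (\<phi> n) x - G x))\<^sup>2 \<partial>?M) < \<tau> * \<delta> / 2"
    using \<tau> \<delta> by (intro order_tendstoD(2)[OF lim]) simp
  then obtain n where "(\<integral>x. (\<phi> n x - u x)\<^sup>2 \<partial>?M) + (\<integral>x. (norm (grad (\<phi> n) x - G x))\<^sup>2 \<partial>?M) < \<tau> * \<delta> / 2"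
    by (auto simp: eventually_sequentially)
  moreover have "(\<integral>x. (norm (grad (\<phi> n) x - G x))\<^sup>2 \<partial>?M) \<ge> 0" by simp
  ultimately have small: "(\<integral>x. (\<phi> n x - u x)\<^sup>2 \<partial>?M) \<le> \<tau> * \<delta> / 2" by linarith
  note \<phi>n = \<phi>[of n]
  have um: "u \<in> borel_measurable ?M" and u2: "integrable ?M (\<lambda>x. (u x)\<^sup>2)"
    using H by (auto simp: H01_with_gradient_def in_Lp_def)
  have \<phi>m: "\<phi> n \<in> borel_measurable ?M"
    using borel_measurable_continuous_onI[OF test_functionD(2)[OF \<phi>n]]
    by (intro measurable_restrict_space1 measurable_completion) simp
  have \<phi>2: "integrable ?M (\<lambda>x. (\<phi> n x)\<^sup>2)"
  proof -
    have "integrable ?M (\<lambda>x. \<phi> n x *\<^sub>R \<phi> n x)"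
    proof (rule integrable_test_function_scaleR[OF \<phi>n \<Omega>(1)])
      fix K :: "'a set" assume K: "compact K" "K \<subseteq> \<Omega>"
      have Km: "K \<inter> space lebesgue \<in> sets lebesgue" using K by (simp add: compact_imp_closed)
      have "integrable lborel (\<lambda>x. indicator K x *\<^sub>R \<phi> n x)"
        using K test_functionD(2)[OF \<phi>n] by (intro borel_integrable_compact)
      then show "integrable (lebesgue_on K) (\<phi> n)"
        unfolding integrable_restrict_space[OF Km]
        by (subst integrable_completion) (auto dest: borel_measurable_integrable)
    qed
    then show ?thesis by (simp add: power2_eq_square)
  qed
  \<comment> \<open>Without integrability the small Bochner integral could be the default value 0
    and carry no information.\<close>
  have diff2: "integrable ?M (\<lambda>x. (\<phi> n x - u x)\<^sup>2)"
  proof (rule Bochner_Integration.integrable_bound)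
    show "integrable ?M (\<lambda>x. 2 * (\<phi> n x)\<^sup>2 + 2 * (u x)\<^sup>2)" using \<phi>2 u2 by simp
    show "(\<lambda>x. (\<phi> n x - u x)\<^sup>2) \<in> borel_measurable ?M" using \<phi>m um by measurable
    have "(\<phi> n x - u x)\<^sup>2 \<le> 2 * (\<phi> n x)\<^sup>2 + 2 * (u x)\<^sup>2" for x
      using zero_le_power2[of "\<phi> n x + u x"] by (simp add: power2_eq_square algebra_simps)
    then show "AE x in ?M. norm ((\<phi> n x - u x)\<^sup>2) \<le> norm (2 * (\<phi> n x)\<^sup>2 + 2 * (u x)\<^sup>2)" by simp
  qed
  have "(\<integral>\<^sup>+ x. ennreal (\<bar>w x - \<phi> n x\<bar> * indicator (ball 0 r) x) \<partial>lborel)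
      \<le> (\<integral>\<^sup>+ x. ennreal \<tau> * indicator (ball (0::'a) r) x + ennreal ((\<phi> n x - u x)\<^sup>2 / \<tau>) * indicator \<Omega> x \<partial>lborel)"
  proof (rule nn_integral_mono_AE)
    show "AE x in lborel. ennreal (\<bar>w x - \<phi> n x\<bar> * indicator (ball 0 r) x)
      \<le> ennreal \<tau> * indicator (ball (0::'a) r) x + ennreal ((\<phi> n x - u x)\<^sup>2 / \<tau>) * indicator \<Omega> x"
      using w
    proof eventually_elim
      case (elim x)
      show ?case
      proof (cases "x \<in> ball 0 r")
        case True
        define a where "a = \<bar>\<phi> n x - u x\<bar>"
        have "a * \<tau> \<le> \<tau>\<^sup>2 + a\<^sup>2"
        proof -
          have "0 \<le> a * \<tau>" using \<tau> by (simp add: a_def)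
          then show ?thesis using sum_squares_bound[of a \<tau>] by linarith
        qed
        then have "a \<le> \<tau> + a\<^sup>2 / \<tau>" using \<tau> by (simp add: field_simps power2_eq_square)
        moreover have "\<bar>w x - \<phi> n x\<bar> = a" using elim True by (simp add: a_def abs_minus_commute)
        ultimately have "ennreal \<bar>w x - \<phi> n x\<bar> \<le> ennreal (\<tau> + (\<phi> n x - u x)\<^sup>2 / \<tau>)"
          by (intro ennreal_leI) (simp add: a_def)
        also have "\<dots> = ennreal \<tau> + ennreal ((\<phi> n x - u x)\<^sup>2 / \<tau>)" using \<tau> by simp
        finally show ?thesis using True \<Omega>(2) by (simp add: indicator_def subset_eq)
      qed simp
    qed
  qed
  also have "\<dots> = (\<integral>\<^sup>+ x. ennreal \<tau> * indicator (ball (0::'a) r) x + ennreal ((\<phi> n x - u x)\<^sup>2 / \<tau>) * indicator \<Omega> x \<partial>lebesgue)"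
    by (rule nn_integral_completion[symmetric])
  also have "\<dots> = (\<integral>\<^sup>+ x. ennreal \<tau> * indicator (ball (0::'a) r) x \<partial>lebesgue)
      + (\<integral>\<^sup>+ x. ennreal ((\<phi> n x - u x)\<^sup>2 / \<tau>) * indicator \<Omega> x \<partial>lebesgue)"
  proof (rule nn_integral_add)
    have "(\<lambda>x. ennreal ((\<phi> n x - u x)\<^sup>2 / \<tau>)) \<in> borel_measurable ?M" using \<phi>m um by measurable
    then show "(\<lambda>x. ennreal ((\<phi> n x - u x)\<^sup>2 / \<tau>) * indicator \<Omega> x) \<in> borel_measurable lebesgue"
      by (simp add: borel_measurable_restrict_space_iff_ennreal[OF open_in_lebesgue[OF \<Omega>(1)]])
    show "(\<lambda>x. ennreal \<tau> * indicator (ball (0::'a) r) x) \<in> borel_measurable lebesgue"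
      by (intro borel_measurable_times_ennreal borel_measurable_indicator borel_measurable_const) simp
  qed
  also have "(\<integral>\<^sup>+ x. ennreal \<tau> * indicator (ball (0::'a) r) x \<partial>lebesgue) = ennreal (\<tau> * v)"
  proof -
    have "emeasure lborel (ball (0::'a) r) = ennreal v"
      unfolding v_def by (rule emeasure_eq_ennreal_measure) (use emeasure_lborel_ball_finite[of "0::'a" r] in auto)
    then show ?thesis using \<tau> v by (simp add: nn_integral_cmult_indicator ennreal_mult)
  qed
  also have "(\<integral>\<^sup>+ x. ennreal ((\<phi> n x - u x)\<^sup>2 / \<tau>) * indicator \<Omega> x \<partial>lebesgue)
      = (\<integral>\<^sup>+ x. ennreal ((\<phi> n x - u x)\<^sup>2 / \<tau>) \<partial>?M)"
    by (rule nn_integral_restrict_space[OF open_in_lebesgue[OF \<Omega>(1)], symmetric])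
  also have "\<dots> = ennreal (\<integral>x. (\<phi> n x - u x)\<^sup>2 / \<tau> \<partial>?M)"
    using diff2 \<tau> by (intro nn_integral_eq_integral) auto
  also have "ennreal (\<tau> * v) + \<dots> \<le> ennreal (\<tau> * v) + ennreal (\<delta> / 2)"
    using small \<tau> by (intro add_left_mono ennreal_leI) (simp add: field_simps)
  also have "\<dots> = ennreal \<delta>"
    using \<tau> v \<delta> by (simp flip: ennreal_plus) (simp add: \<tau>_def)
  finally show ?thesis
    using integrable_test_function[OF \<phi>n] uniformly_continuous_test_function[OF \<phi>n] by blast
qed

text \<open>On a ball |u| <= 1 + u^2 turns square integrability into integrability. Cutting off by
  zero gives a function on the whole space, which is then changed on a null set to become
  Borel.\<close>

lemma borel_representative:
  fixes u :: "'a::euclidean_space \<Rightarrow> real"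
  assumes u: "in_Lp 2 \<Omega> u" and \<Omega>: "open \<Omega>" "ball 0 r \<subseteq> \<Omega>"
  shows "\<exists>w. integrable lborel w \<and> (AE y in lborel. y \<in> ball 0 r \<longrightarrow> w y = u y)"
proof -
  let ?M = "lebesgue_on \<Omega>"
  define f where "f y = (if y \<in> ball 0 r then u y else 0)" for y
  have um: "u \<in> borel_measurable ?M" and u2: "integrable ?M (\<lambda>x. (u x)\<^sup>2)"
    using u by (auto simp: in_Lp_def)
  have uI: "(\<lambda>x. indicator \<Omega> x *\<^sub>R u x) \<in> borel_measurable lebesgue"
    using um by (simp add: borel_measurable_restrict_space_iff[OF open_in_lebesgue[OF \<Omega>(1)]])
  have f_eq: "f = (\<lambda>x. indicator (ball 0 r) x * (indicator \<Omega> x *\<^sub>R u x))"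
    using \<Omega>(2) by (auto simp: f_def fun_eq_iff indicator_def)
  have fm: "f \<in> borel_measurable lebesgue"
    unfolding f_eq by (intro borel_measurable_times borel_measurable_indicator uI) simp
  have fi: "integrable lebesgue f"
  proof (rule Bochner_Integration.integrable_bound)
    have "integrable lborel (indicator (ball (0::'a) r) :: 'a \<Rightarrow> real)"
      by (intro integrable_real_indicator) (use emeasure_lborel_ball_finite[of "0::'a" r] in auto)
    then have "integrable lebesgue (indicator (ball (0::'a) r) :: 'a \<Rightarrow> real)"
      by (subst integrable_completion) auto
    moreover have "integrable lebesgue (\<lambda>x. indicator \<Omega> x *\<^sub>R (u x)\<^sup>2)"
      using u2 by (simp add: integrable_restrict_space[OF open_in_lebesgue[OF \<Omega>(1)]])
    ultimately show "integrable lebesgue (\<lambda>x. indicator (ball 0 r) x + indicator \<Omega> x *\<^sub>R (u x)\<^sup>2)"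
      by (rule Bochner_Integration.integrable_add)
    have "\<bar>f x\<bar> \<le> indicator (ball 0 r) x + indicator \<Omega> x *\<^sub>R (u x)\<^sup>2" for x
    proof -
      have "\<bar>u x\<bar> \<le> 1 + (u x)\<^sup>2"
        using sum_squares_bound[of 1 "\<bar>u x\<bar>"] by simp
      then show ?thesis using \<Omega>(2) by (auto simp: f_def indicator_def)
    qed
    then show "AE x in lebesgue. norm (f x) \<le> norm (indicator (ball 0 r) x + indicator \<Omega> x *\<^sub>R (u x)\<^sup>2)"
      by (intro AE_I2) (auto intro: order_trans[OF _ abs_ge_self])
  qed (rule fm)
  obtain w where w: "w \<in> borel_measurable lborel" "AE x in lborel. f x = w x"
    using completion_ex_borel_measurable_real[OF fm] by blast
  have "integrable lebesgue w"
    using integrable_cong_AE_imp[OF fi measurable_completion[OF w(1)] AE_completion[OF w(2)]] .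
  then have "integrable lborel w" using w(1) by (simp add: integrable_completion)
  moreover have "AE y in lborel. y \<in> ball 0 r \<longrightarrow> w y = u y"
    using w(2) by eventually_elim (auto simp: f_def)
  ultimately show ?thesis by blast
qed

section \<open>Pointwise gradient bounds near the singularity\<close>

lemma grad_bound_of_derivative:
  fixes f :: "'a::euclidean_space \<Rightarrow> real"
  assumes "(f has_derivative f') (at x)" "\<And>h. \<bar>f' h\<bar> \<le> c * norm h"
  shows "f differentiable (at x)" "norm (grad f x) \<le> c"
proof -
  show d: "f differentiable (at x)" using assms(1) unfolding differentiable_def by blast
  have "f' = (\<lambda>h. h \<bullet> grad f x)"
    using GDERIV_grad[OF d] assms(1) has_derivative_unique unfolding gderiv_def by blast
  then have "(norm (grad f x))\<^sup>2 = f' (grad f x)" by (simp add: power2_norm_eq_inner)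
  also have "\<dots> \<le> c * norm (grad f x)" using assms(2)[of "grad f x"] by linarith
  finally have le: "norm (grad f x) * norm (grad f x) \<le> c * norm (grad f x)" by (simp add: power2_eq_square)
  show "norm (grad f x) \<le> c"
  proof (cases "grad f x = 0")
    \<comment> \<open>Cancelling the norm is impossible here; that c is nonnegative is read off from
      a basis vector.\<close>
    case True
    obtain b :: 'a where "b \<in> Basis" using nonempty_Basis by blast
    then have "\<bar>f' b\<bar> \<le> c" using assms(2)[of b] by simp
    then show ?thesis using True by simp
  next
    case False
    then show ?thesis using le by simp
  qed
qed

text \<open>The left side is K^p d^(1 - a p), and 1 - a p >= -(a + 1) is exactly a (p - 1) <= 2.
  Comparing the powers needs d <= 1, which is where the normalization of the radii enters.\<close>

lemma singular_powers_bound: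
  fixes d a p K :: real
  assumes "0 < d" "d \<le> 1" "K \<ge> 0" "p \<ge> 0" "a * (p - 1) \<le> 2"
  shows "(K * d powr (- a)) powr p * d \<le> K powr p * d powr (- (a + 1))"
proof -
  have "(K * d powr (- a)) powr p * d = K powr p * (d powr (- a * p) * d powr 1)"
    using assms by (simp add: powr_mult powr_powr)
  also have "d powr (- a * p) * d powr 1 = d powr (1 - a * p)"
    unfolding powr_add[symmetric] by simp
  also have "d powr (1 - a * p) \<le> d powr (- (a + 1))"
  proof (rule powr_mono')
    show "- (a + 1) \<le> 1 - a * p" using assms(5) by (simp add: algebra_simps)
  qed (use assms in auto)
  finally show ?thesis using assms by (simp add: mult_left_mono)
qed

text \<open>The ball estimate is applied on \<open>ball x (norm x / 2)\<close>. The condition on a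
  keeps the nonlinear terms from being more singular than the linear ones; C is fixed before the
  domain, the solution and the radius.\<close>

proposition interior_gradient_bound:
  fixes a p q \<mu> K :: real
  assumes a: "a \<ge> 0" "a * (q - 1) \<le> 2" and p: "1 \<le> p" "p \<le> q" and \<mu>: "\<mu> \<ge> 0"
  shows "\<exists>C. \<forall>(\<Omega> :: 'a::euclidean_space set) u r.
    open \<Omega> \<and> weak_solution \<mu> p q \<Omega> u \<and> bound_radius \<Omega> u K a r \<longrightarrow>
      (\<exists>v. (AE x in lebesgue_on \<Omega>. v x = u x) \<and>
        (\<forall>x. 0 < norm x \<and> norm x < r / 2 \<longrightarrow>
          v differentiable (at x) \<and> norm (grad v x) \<le> C * norm x powr (- (a + 1))))"
proof -
  obtain C0 where C0: "C0 \<ge> 0" and est: "\<forall>(w :: 'a \<Rightarrow> real) x0 R M H. integrable lborel w \<and> R > 0 \<and> H \<ge> 0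
     \<and> (AE y in lborel. y \<in> ball x0 R \<longrightarrow> \<bar>w y\<bar> \<le> M) \<and> weakly_bounded_laplacian (ball x0 R) w H \<longrightarrow>
     (\<exists>V V'. (\<forall>x\<in>ball x0 (R / 2). (\<lambda>k. mollify (real DIM('a)) (radial 1) w (real k) x) \<longlonglongrightarrow> V x)
        \<and> (V has_derivative V') (at x0) \<and> (\<forall>h. \<bar>V' h\<bar> \<le> C0 * (M / R + H * R) * norm h))"
    using gradient_estimate_ball[where ?'a = 'a] by (elim exE conjE)
  define m where "m = bump_mass TYPE('a)"
  have m: "m > 0" by (simp add: m_def bump_mass_pos)
  \<comment> \<open>K carries no sign condition; its absolute value keeps the bound M on u
    nonnegative.\<close>
  define L where "L = \<bar>K\<bar>"
  \<comment> \<open>1 + \<mu> collects M/d and the singular potential, the powers of L come from the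
    nonlinearity, 1/m undoes the kernel mass, and 2^(a+1) converts d = |x|/2 back to |x|.\<close>
  define C where "C = C0 * ((1 + \<mu>) * L + L powr p + L powr q) / m * 2 powr (a + 1)"
  have pq: "a * (p - 1) \<le> 2" using a p mult_left_mono[of "p - 1" "q - 1" a] by linarith
  show ?thesis
  proof (intro exI[of _ C] allI impI)
    fix \<Omega> :: "'a set" and u r
    assume asm: "open \<Omega> \<and> weak_solution \<mu> p q \<Omega> u \<and> bound_radius \<Omega> u K a r"
    then have \<Omega>: "open \<Omega>" and sol: "weak_solution \<mu> p q \<Omega> u" and r: "0 < r" "r \<le> 1" "ball 0 r \<subseteq> \<Omega>"
      and upper: "AE x in lborel. x \<in> ball 0 r \<longrightarrow> u x \<le> K * norm x powr (- a)"
      by (auto simp: bound_radius_def AE_lebesgue_on_open)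
    have pos: "AE x in lborel. x \<in> \<Omega> \<longrightarrow> u x > 0"
      using sol by (simp add: weak_solution_def AE_lebesgue_on_open[OF \<Omega>])
    obtain G where G: "H01_with_gradient \<Omega> u G" using sol unfolding weak_solution_def by blast
    obtain w where w: "integrable lborel w" and wu: "AE y in lborel. y \<in> ball 0 r \<longrightarrow> w y = u y"
      using borel_representative[OF _ \<Omega> r(3), of u] G by (auto simp: H01_with_gradient_def)
    \<comment> \<open>Cut at r/2 because the limit is identified with u only on half the ball; this
      accounts for the factor 1/2 in the final radius.\<close>
    define S where "S = {x::'a. 0 < norm x \<and> norm x < r / 2}"
    have "open S" unfolding S_def by (intro open_Collect_conj open_Collect_less continuous_intros)
    \<comment> \<open>The ball estimate gives a different V at each centre. Taking
      \<open>lim\<close> of the mollifications defines one function that agrees with every such V on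
      its own ball, so v is consistent.\<close>
    define W where "W x = lim (\<lambda>k. mollify (real DIM('a)) (radial 1) w (real k) x)" for x
    define v where "v x = (if x \<in> S then W x / m else u x)" for x
    have local: "(\<lambda>k. mollify (real DIM('a)) (radial 1) w (real k) x) \<longlonglongrightarrow> W x
        \<and> v differentiable (at x) \<and> norm (grad v x) \<le> C * norm x powr (- (a + 1))"
      if x: "x \<in> S" for x
    proof -
      define d where "d = norm x / 2"
      have d: "0 < d" "d \<le> 1" "2 * d < r / 2" using x r by (auto simp: S_def d_def)
      have annulus: "d \<le> norm y" "y \<in> ball 0 r" if "y \<in> ball x d" for y
      proof -
        have "norm (x - y) < d" using that by (simp add: dist_norm)
        then show "d \<le> norm y" "y \<in> ball 0 r"
          using norm_triangle_sub[of x y] norm_triangle_sub[of y x] d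
          by (auto simp: d_def norm_minus_commute)
      qed
      define M where "M = L * d powr (- a)"
      have M0: "M \<ge> 0" by (simp add: M_def L_def)
      have M: "AE y in lborel. y \<in> ball x d \<longrightarrow> u y \<le> M"
        using upper
      proof eventually_elim
        case (elim y)
        show ?case
        proof
          assume y: "y \<in> ball x d"
          have "u y \<le> K * norm y powr (- a)" using elim annulus(2)[OF y] by blast
          also have "\<dots> \<le> L * norm y powr (- a)" by (intro mult_right_mono) (auto simp: L_def)
          also have "norm y powr (- a) \<le> d powr (- a)"
            using d annulus(1)[OF y] a by (intro powr_mono2') auto
          finally show "u y \<le> M" by (simp add: M_def L_def mult_left_mono)
        qed
      qed
      have wu': "AE y in lborel. y \<in> ball x d \<longrightarrow> w y = u y"
        using wu by eventually_elim (use annulus(2) in blast)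
      have wM: "AE y in lborel. y \<in> ball x d \<longrightarrow> \<bar>w y\<bar> \<le> M"
        using wu' M pos
      proof eventually_elim
        case (elim y)
        then show ?case using annulus(2)[of y] r(3) by fastforce
      qed
      define H where "H = \<mu> * (M / d\<^sup>2) + (M powr p + M powr q)"
      have H0: "H \<ge> 0" using \<mu> M0 by (simp add: H_def)
      have sub: "ball x d \<subseteq> \<Omega>" using annulus(2) r(3) by blast
      have H: "weakly_bounded_laplacian (ball x d) w H"
        unfolding H_def
        by (rule weak_solution_weakly_bounded_laplacian[OF sol \<Omega> sub \<mu> _ _ d(1) annulus(1) M0 M _ wu'])
           (use p borel_measurable_integrable[OF w] in auto)
      obtain V V' where V: "\<And>y. y \<in> ball x (d / 2) \<Longrightarrow> (\<lambda>k. mollify (real DIM('a)) (radial 1) w (real k) y) \<longlonglongrightarrow> V y"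
        and V': "(V has_derivative V') (at x)" and V'_le: "\<And>h. \<bar>V' h\<bar> \<le> C0 * (M / d + H * d) * norm h"
        using est[rule_format, OF conjI[OF w conjI[OF d(1) conjI[OF H0 conjI[OF wM H]]]]] by blast
      have WV: "W y = V y" if "y \<in> ball x (d / 2)" for y
        unfolding W_def using limI[OF V[OF that]] .
      have conv: "(\<lambda>k. mollify (real DIM('a)) (radial 1) w (real k) x) \<longlonglongrightarrow> W x"
        using V[of x] WV[of x] d by simp
      have "((\<lambda>y. V y / m) has_derivative (\<lambda>h. V' h / m)) (at x)"
        using bounded_linear.has_derivative[OF bounded_linear_divide V'] .
      \<comment> \<open>Differentiability is local, and near x the function v is V/m.\<close>
      then have v': "(v has_derivative (\<lambda>h. V' h / m)) (at x)"
      proof (rule has_derivative_transform_within_open)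
        show "open (S \<inter> ball x (d / 2))" using \<open>open S\<close> by auto
        show "x \<in> S \<inter> ball x (d / 2)" using x d by simp
        show "V y / m = v y" if "y \<in> S \<inter> ball x (d / 2)" for y
          using that WV by (simp add: v_def)
      qed
      have Md: "M / d = L * d powr (- (a + 1))"
        using d by (simp add: M_def powr_diff powr_minus_divide powr_add field_simps)
      have "M / d + H * d = (1 + \<mu>) * (M / d) + (M powr p * d + M powr q * d)"
        using d by (simp add: H_def power2_eq_square field_simps)
      also have "\<dots> = (1 + \<mu>) * (L * d powr (- (a + 1))) + (M powr p * d + M powr q * d)"
        by (simp only: Md)
      also have "(1 + \<mu>) * (L * d powr (- (a + 1))) + (M powr p * d + M powr q * d)
        \<le> (1 + \<mu>) * (L * d powr (- (a + 1))) + (L powr p * d powr (- (a + 1)) + L powr q * d powr (- (a + 1)))"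
        unfolding M_def using d a p pq by (intro add_left_mono add_mono singular_powers_bound) (auto simp: L_def)
      also have "\<dots> = ((1 + \<mu>) * L + L powr p + L powr q) * d powr (- (a + 1))"
        by (simp add: algebra_simps)
      finally have total: "M / d + H * d \<le> ((1 + \<mu>) * L + L powr p + L powr q) * d powr (- (a + 1))" .
      have dpow: "d powr (- (a + 1)) = 2 powr (a + 1) * norm x powr (- (a + 1))"
        unfolding d_def by (subst powr_divide) (simp_all only: powr_minus divide_inverse inverse_inverse_eq mult.commute norm_ge_zero zero_le_numeral)
      have "C0 * (M / d + H * d) / m \<le> C0 * (((1 + \<mu>) * L + L powr p + L powr q) * d powr (- (a + 1))) / m"
        using total C0 m by (intro divide_right_mono mult_left_mono) auto
      also have "\<dots> = C * norm x powr (- (a + 1))" unfolding C_def dpow by simp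
      finally have Cx: "C0 * (M / d + H * d) / m \<le> C * norm x powr (- (a + 1))" .
      have "\<bar>V' h / m\<bar> \<le> C * norm x powr (- (a + 1)) * norm h" for h
      proof -
        have "\<bar>V' h / m\<bar> \<le> C0 * (M / d + H * d) * norm h / m"
          using V'_le[of h] m by (simp add: abs_divide divide_right_mono)
        also have "\<dots> = (C0 * (M / d + H * d) / m) * norm h" by simp
        also have "\<dots> \<le> C * norm x powr (- (a + 1)) * norm h" using Cx by (rule mult_right_mono) simp
        finally show ?thesis .
      qed
      from grad_bound_of_derivative[OF v' this] conv show ?thesis by blast
    qed
    have "AE x in lborel. x \<in> S \<longrightarrow> W x = m * w x"
      unfolding m_def
    proof (rule mollify_limit_eq_AE[OF w r(1)])
      show "\<exists>\<phi>. integrable lborel \<phi> \<and> uniformly_continuous_on UNIV \<phi> \<and>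
        (\<integral>\<^sup>+ x. ennreal (\<bar>w x - \<phi> x\<bar> * indicator (ball 0 r) x) \<partial>lborel) \<le> ennreal \<delta>" if "\<delta> > 0" for \<delta>
        by (rule H01_L1_approximation[OF G \<Omega> r(3,1) wu that])
      show "S \<subseteq> ball 0 (r / 2)" by (auto simp: S_def)
    qed (use local in blast)
    \<comment> \<open>On S the mass m cancels and w = u almost everywhere; elsewhere v is u by
      definition.\<close>
    then have "AE x in lborel. v x = u x"
      using wu
    proof eventually_elim
      case (elim x)
      then show ?case using m r(1) by (cases "x \<in> S") (auto simp: v_def S_def)
    qed
    then have "AE x in lebesgue_on \<Omega>. v x = u x"
      unfolding AE_lebesgue_on_open[OF \<Omega>] by eventually_elim simp
    then show "\<exists>v. (AE x in lebesgue_on \<Omega>. v x = u x) \<and>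
        (\<forall>x. 0 < norm x \<and> norm x < r / 2 \<longrightarrow>
          v differentiable (at x) \<and> norm (grad v x) \<le> C * norm x powr (- (a + 1)))"
      using local by (intro exI[of _ v]) (auto simp: S_def)
  qed
qed

section \<open>The threshold for \<mu> and the two regimes\<close>

theorem theorem1p8:
  fixes N :: nat and q :: real
  assumes "N = DIM('a::euclidean_space)" and "N \<ge> 3"
  shows "\<exists>\<mu>s. 0 < \<mu>s \<and> \<mu>s < mu_bar N \<and>
    (\<forall>p \<mu> K. crit_exp N - 1 \<le> p \<and> p \<le> (p - 1) * (real N / 2) - 1 \<and> (p - 1) * (real N / 2) - 1 < q
        \<and> 0 \<le> \<mu> \<and> \<mu> < mu_bar N \<longrightarrow>
      (\<exists>C. \<forall>(\<Omega> :: 'a set) \<rho>0 \<rho> u.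
         smooth_domain \<Omega> \<and> 0 \<in> \<Omega> \<and> weak_solution \<mu> p q \<Omega> u \<and>
         admissible_radii N p q \<mu> \<Omega> u K \<rho>0 \<rho> \<longrightarrow>
         (\<exists>v. (AE x in lebesgue_on \<Omega>. v x = u x) \<and>
            (\<forall>x. 0 < norm x \<and> norm x < 1 / 2 * min \<rho>0 \<rho> \<longrightarrow>
               v differentiable (at x) \<and>
               norm (grad v x) \<le>
                 (if \<mu> < \<mu>s then C * norm x powr (- (nu N \<mu> + 1))
                  else C * norm x powr (- ((q + 1) / (q - 1))))))))"
proof -
  define h where "h = (real N - 2) / 2"
  have h: "h > 0" using assms(2) by (simp add: h_def)
  have mu_bar: "mu_bar N = h\<^sup>2" by (simp add: mu_bar_def h_def)
  have sqrt_mu_bar: "sqrt (mu_bar N) = h" unfolding mu_bar using h by simp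
  define b where "b = 2 / (q - 1)"
  \<comment> \<open>With h the root of \<open>mu_bar N\<close>, this solves h - sqrt (h^2 - \<mu>) =
    b, that is \<nu> = 2/(q - 1). It is chosen before p, when b in (0, h) is not yet known; the
    other value merely secures 0 < \<open>\<mu>s\<close> < \<open>mu_bar N\<close>.\<close>
  define \<mu>s where "\<mu>s = (if 0 < b \<and> b < h then h\<^sup>2 - (h - b)\<^sup>2 else h\<^sup>2 / 2)"
  have \<mu>s: "0 < \<mu>s" "\<mu>s < mu_bar N"
    using h by (auto simp: \<mu>s_def mu_bar intro!: power_strict_mono)
  show ?thesis
  proof (rule exI[of _ \<mu>s], intro conjI \<mu>s allI impI)
    fix p \<mu> K :: real
    assume asm: "crit_exp N - 1 \<le> p \<and> p \<le> (p - 1) * (real N / 2) - 1 \<and> (p - 1) * (real N / 2) - 1 < q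
        \<and> 0 \<le> \<mu> \<and> \<mu> < mu_bar N"
    then have \<mu>: "0 \<le> \<mu>" "\<mu> < h\<^sup>2" and p_crit: "crit_exp N - 1 \<le> p" and pq: "p < q" by (auto simp: mu_bar)
    \<comment> \<open>(N + 2)/(N - 2) = 1 + 4/(N - 2). Together with p < q this yields q - 1 > 2/h,
      hence b < h, so \<open>\<mu>s\<close> is the genuine root.\<close>
    have crit: "crit_exp N - 1 = 1 + 2 / h"
      using h assms(2) by (simp add: crit_exp_def h_def field_simps)
    have p1: "1 \<le> p" and q_large: "q - 1 > 2 / h" using p_crit pq h unfolding crit by (auto intro: order_trans[of 1 "1 + 2 / h"])
    have q1: "q > 1" using q_large h by (smt (verit) divide_pos_pos)
    have b: "0 < b" "b < h" using q1 q_large h by (auto simp: b_def field_simps)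
    then have \<mu>s_eq: "\<mu>s = h\<^sup>2 - (h - b)\<^sup>2" by (simp add: \<mu>s_def)
    define n where "n = nu N \<mu>"
    have n_eq: "n = h - sqrt (h\<^sup>2 - \<mu>)" by (simp add: n_def nu_def sqrt_mu_bar) (simp add: mu_bar)
    have n0: "n \<ge> 0" using \<mu> h by (simp add: n_eq real_le_lsqrt)
    have b_exp: "b + 1 = (q + 1) / (q - 1)" using q1 by (simp add: b_def field_simps)
    have n_less: "n \<le> b" if "\<mu> < \<mu>s"
    proof -
      have "(h - b)\<^sup>2 \<le> h\<^sup>2 - \<mu>" using that by (simp add: \<mu>s_eq)
      then have "h - b \<le> sqrt (h\<^sup>2 - \<mu>)" using b by (intro real_le_rsqrt)
      then show ?thesis by (simp add: n_eq)
    qed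
    have n_ge: "b \<le> n" if "\<not> \<mu> < \<mu>s"
    proof -
      have "h\<^sup>2 - \<mu> \<le> (h - b)\<^sup>2" using that by (simp add: \<mu>s_eq)
      then have "sqrt (h\<^sup>2 - \<mu>) \<le> h - b" using b by (intro real_le_lsqrt) auto
      then show ?thesis by (simp add: n_eq)
    qed
    \<comment> \<open>This is the smaller of n and b, since n is monotone in \<mu> and meets b at
      \<open>\<mu>s\<close>; hence a (q - 1) <= b (q - 1) = 2.\<close>
    define a where "a = (if \<mu> < \<mu>s then n else b)"
    have a: "a \<ge> 0" "a * (q - 1) \<le> 2"
    proof -
      show "a \<ge> 0" using n0 b by (simp add: a_def)
      have "a \<le> b" using n_less by (simp add: a_def)
      then have "a * (q - 1) \<le> b * (q - 1)" using q1 by (intro mult_right_mono) auto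
      moreover have "b * (q - 1) = 2"
        using q1 unfolding b_def by (subst nonzero_eq_divide_eq[symmetric]) auto
      ultimately show "a * (q - 1) \<le> 2" by linarith
    qed
    obtain C where C: "\<And>(\<Omega> :: 'a set) u r. open \<Omega> \<Longrightarrow> weak_solution \<mu> p q \<Omega> u \<Longrightarrow> bound_radius \<Omega> u K a r \<Longrightarrow>
      \<exists>v. (AE x in lebesgue_on \<Omega>. v x = u x) \<and>
        (\<forall>x. 0 < norm x \<and> norm x < r / 2 \<longrightarrow>
          v differentiable (at x) \<and> norm (grad v x) \<le> C * norm x powr (- (a + 1)))"
      using interior_gradient_bound[OF a p1 less_imp_le[OF pq] \<mu>(1), of K, where ?'a = 'a] by blast
    show "\<exists>C. \<forall>(\<Omega> :: 'a set) \<rho>0 \<rho> u.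
         smooth_domain \<Omega> \<and> 0 \<in> \<Omega> \<and> weak_solution \<mu> p q \<Omega> u \<and>
         admissible_radii N p q \<mu> \<Omega> u K \<rho>0 \<rho> \<longrightarrow>
         (\<exists>v. (AE x in lebesgue_on \<Omega>. v x = u x) \<and>
            (\<forall>x. 0 < norm x \<and> norm x < 1 / 2 * min \<rho>0 \<rho> \<longrightarrow>
               v differentiable (at x) \<and>
               norm (grad v x) \<le>
                 (if \<mu> < \<mu>s then C * norm x powr (- (nu N \<mu> + 1))
                  else C * norm x powr (- ((q + 1) / (q - 1))))))"
    proof (intro exI[of _ C] allI impI)
      fix \<Omega> :: "'a set" and \<rho>0 \<rho> u
      assume asm2: "smooth_domain \<Omega> \<and> 0 \<in> \<Omega> \<and> weak_solution \<mu> p q \<Omega> u \<and> admissible_radii N p q \<mu> \<Omega> u K \<rho>0 \<rho>"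
      then have \<Omega>: "open \<Omega>" and sol: "weak_solution \<mu> p q \<Omega> u" and \<rho>0: "bound_radius \<Omega> u K n \<rho>0"
        and \<rho>: "n > 0 \<and> q > max p ((2 + n) / n) \<Longrightarrow> bound_radius \<Omega> u K b \<rho>"
        by (auto simp: smooth_domain_def admissible_radii_def n_def b_def)
      (* At n = b the bound on rho is not available, but the bound on rho0 has the same exponent. *)
      have "\<exists>r \<ge> min \<rho>0 \<rho>. bound_radius \<Omega> u K a r"
      proof (cases "\<mu> < \<mu>s \<or> n = b")
        case True
        then have "a = n" by (auto simp: a_def)
        then show ?thesis using \<rho>0 by (intro exI[of _ \<rho>0]) auto
      next
        case False
        then have "n > b" using n_ge by force
        \<comment> \<open>Equivalent to q > (2 + n)/n, so strictly beyond the threshold the bound on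
          the radius \<rho> becomes available.\<close>
        then have "2 < n * (q - 1)" using q1 by (simp add: b_def field_simps)
        then have "q > (2 + n) / n" "n > 0" using \<open>n > b\<close> b by (auto simp: field_simps)
        then show ?thesis using \<rho> pq False by (intro exI[of _ \<rho>]) (auto simp: a_def)
      qed
      then obtain r where r: "min \<rho>0 \<rho> \<le> r" "bound_radius \<Omega> u K a r" by blast
      from C[OF \<Omega> sol r(2)] obtain v where v: "AE x in lebesgue_on \<Omega>. v x = u x"
        "\<And>x. 0 < norm x \<Longrightarrow> norm x < r / 2 \<Longrightarrow>
          v differentiable (at x) \<and> norm (grad v x) \<le> C * norm x powr (- (a + 1))" by blast
      have "(if \<mu> < \<mu>s then C * norm x powr (- (nu N \<mu> + 1)) else C * norm x powr (- ((q + 1) / (q - 1))))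
         = C * norm x powr (- (a + 1))" for x :: 'a
        by (simp only: a_def n_def b_exp[symmetric] if_distrib split: if_split) simp
      moreover have "norm x < r / 2" if "norm x < 1 / 2 * min \<rho>0 \<rho>" for x :: 'a
        using that r(1) by linarith
      ultimately show "\<exists>v. (AE x in lebesgue_on \<Omega>. v x = u x) \<and>
            (\<forall>x. 0 < norm x \<and> norm x < 1 / 2 * min \<rho>0 \<rho> \<longrightarrow>
               v differentiable (at x) \<and>
               norm (grad v x) \<le>
                 (if \<mu> < \<mu>s then C * norm x powr (- (nu N \<mu> + 1))
                  else C * norm x powr (- ((q + 1) / (q - 1)))))"
        using v by (intro exI[of _ v] conjI allI impI) auto
    qed
  qed
qed

end
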